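(* For every $p = p(n) \in [1, \infty)$ and every integer $k \geq 2$ there is a polynomial-time reduction from any (Weighted-)Max-$k$-SAT instance with $n$ variables and $m$ clauses to a $\mathrm{CVP}_p$ instance of rank $n + (k - 2)m$.
   Context: Weighted Max-$k$-SAT: given a formula on $n$ variables with clauses $C_1,\dots,C_m$, each a disjunction of $k$ literals, a weight function assigning a positive integer $w(C_i)$ to each clause, and a threshold $W$, decide whether some assignment satisfies clauses of total weight at least $W$ (Max-$k$-SAT is the case of unit weights). A lattice of rank $N$ is $\mathcal{L}(B)=\{B\vec z:\vec z\in\mathbb{Z}^N\}$ for $B\in\mathbb{R}^{d\times N}$ with linearly independent columns. $\mathrm{CVP}_p$: given $B$, $\vec t\in\mathbb{R}^d$ and $r>0$, decide whether $\min_{\vec x\in\mathcal{L}(B)}\|\vec x-\vec t\|_p\le r$, where $\|\vec x\|_p=(\sum_i|x_i|^p)^{1/p}$. *)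

theory Defs
  imports
    "HOL-Computational_Algebra.Polynomial"
    "Jordan_Normal_Form.Matrix"
begin

section \<open>Polynomial time\<close>

text \<open>
  The machine model is the language WHILE of N. D. Jones (Computability and Complexity from a
  Programming Perspective): programs with finitely many variables that hold binary trees.
  An expression is charged for the full size of every value that it reads, so data are copied and
  never shared. In time \<open>T\<close> a program therefore only produces trees of size at most
  \<open>T\<close>, and polynomial time here is polynomial time on Turing machines, also for
  functions (and not only for decision problems).
\<close>

datatype tree = Leaf | Node tree tree

fun tree_size :: "tree \<Rightarrow> nat" where
  "tree_size Leaf = 1"
| "tree_size (Node a b) = 1 + tree_size a + tree_size b"

datatype exp = Var nat | LeafE | NodeE exp exp | HdE exp | TlE exp

fun hd_tree :: "tree \<Rightarrow> tree" where
  "hd_tree Leaf = Leaf"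
| "hd_tree (Node a b) = a"

fun tl_tree :: "tree \<Rightarrow> tree" where
  "tl_tree Leaf = Leaf"
| "tl_tree (Node a b) = b"

type_synonym store = "nat \<Rightarrow> tree"

fun eval_exp :: "exp \<Rightarrow> store \<Rightarrow> tree" where
  "eval_exp (Var x) s = s x"
| "eval_exp LeafE s = Leaf"
| "eval_exp (NodeE a b) s = Node (eval_exp a s) (eval_exp b s)"
| "eval_exp (HdE a) s = hd_tree (eval_exp a s)"
| "eval_exp (TlE a) s = tl_tree (eval_exp a s)"

fun exp_cost :: "exp \<Rightarrow> store \<Rightarrow> nat" where
  "exp_cost (Var x) s = tree_size (s x)"
| "exp_cost LeafE s = 1"
| "exp_cost (NodeE a b) s = 1 + exp_cost a s + exp_cost b s"
| "exp_cost (HdE a) s = 1 + exp_cost a s"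
| "exp_cost (TlE a) s = 1 + exp_cost a s"

lemma tree_size_eval_exp_le: "tree_size (eval_exp e s) \<le> exp_cost e s"
proof (induction e)
  case (HdE e)
  then show ?case by (cases "eval_exp e s") auto
next
  case (TlE e)
  then show ?case by (cases "eval_exp e s") auto
qed auto

datatype com = Skip | Assign nat exp | Seq com com | Cond exp com com | While exp com

text \<open>\<open>exec c s t s'\<close>: started in \<open>s\<close>, the program \<open>c\<close> halts in \<open>s'\<close> after time \<open>t\<close>.
  In tests \<open>Leaf\<close> is false and every other tree is true.\<close>

inductive exec :: "com \<Rightarrow> store \<Rightarrow> nat \<Rightarrow> store \<Rightarrow> bool" where
  exec_Skip: "exec Skip s 1 s"
| exec_Assign: "exec (Assign x e) s (1 + exp_cost e s) (s(x := eval_exp e s))"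
| exec_Seq: "exec c1 s t1 s1 \<Longrightarrow> exec c2 s1 t2 s2 \<Longrightarrow> exec (Seq c1 c2) s (t1 + t2) s2"
| exec_CondTrue: "eval_exp e s \<noteq> Leaf \<Longrightarrow> exec c1 s t s1 \<Longrightarrow>
    exec (Cond e c1 c2) s (1 + exp_cost e s + t) s1"
| exec_CondFalse: "eval_exp e s = Leaf \<Longrightarrow> exec c2 s t s1 \<Longrightarrow>
    exec (Cond e c1 c2) s (1 + exp_cost e s + t) s1"
| exec_WhileFalse: "eval_exp e s = Leaf \<Longrightarrow> exec (While e c) s (1 + exp_cost e s) s"
| exec_WhileTrue: "eval_exp e s \<noteq> Leaf \<Longrightarrow> exec c s t1 s1 \<Longrightarrow> exec (While e c) s1 t2 s2 \<Longrightarrow>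
    exec (While e c) s (1 + exp_cost e s + t1 + t2) s2"

lemma exec_deterministic:
  "exec c s t s' \<Longrightarrow> exec c s u s'' \<Longrightarrow> u = t \<and> s'' = s'"
proof (induction arbitrary: u s'' rule: exec.induct)
  case (exec_Skip s)
  then show ?case by (auto elim: exec.cases)
next
  case (exec_Assign x e s)
  then show ?case by (auto elim: exec.cases)
next
  case (exec_Seq c1 s t1 s1 c2 t2 s2)
  from exec_Seq.prems show ?case by cases (use exec_Seq.IH in blast)
next
  case (exec_CondTrue e s c1 t s1 c2)
  from exec_CondTrue.prems show ?case by cases (use exec_CondTrue.hyps exec_CondTrue.IH in blast)+
next
  case (exec_CondFalse e s c2 t s1 c1)
  from exec_CondFalse.prems show ?case by cases (use exec_CondFalse.hyps exec_CondFalse.IH in blast)+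
next
  case (exec_WhileFalse e s c)
  from exec_WhileFalse.prems show ?case by cases (use exec_WhileFalse.hyps in blast)+
next
  case (exec_WhileTrue e s c t1 s1 t2 s2)
  from exec_WhileTrue.prems show ?case by cases (use exec_WhileTrue.hyps exec_WhileTrue.IH in blast)+
qed

text \<open>Input and output are passed in variable \<open>0\<close>; all other variables start with \<open>Leaf\<close>.\<close>

definition poly_time_computable ::
    "('a \<Rightarrow> tree) \<Rightarrow> ('b \<Rightarrow> tree) \<Rightarrow> 'a set \<Rightarrow> ('a \<Rightarrow> 'b) \<Rightarrow> bool" where
  "poly_time_computable enc_in enc_out S f \<longleftrightarrow>
     (\<exists>(c :: com) (q :: nat poly). \<forall>x\<in>S. \<exists>t s.
        exec c ((\<lambda>_. Leaf)(0 := enc_in x)) t s \<and>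
        s 0 = enc_out (f x) \<and>
        t \<le> poly q (tree_size (enc_in x)))"


section \<open>Encodings\<close>

definition enc_bool :: "bool \<Rightarrow> tree" where
  "enc_bool b = (if b then Node Leaf Leaf else Leaf)"

fun enc_list :: "('a \<Rightarrow> tree) \<Rightarrow> 'a list \<Rightarrow> tree" where
  "enc_list f [] = Leaf"
| "enc_list f (x # xs) = Node (f x) (enc_list f xs)"

definition enc_unary :: "nat \<Rightarrow> tree" where
  "enc_unary n = enc_list (\<lambda>_. Leaf) (replicate n ())"

fun enc_binary :: "nat \<Rightarrow> tree" where
  "enc_binary n = (if n = 0 then Leaf else Node (enc_bool (odd n)) (enc_binary (n div 2)))"

declare enc_binary.simps [simp del]

definition enc_int :: "int \<Rightarrow> tree" where
  "enc_int i = Node (enc_bool (i < 0)) (enc_binary (nat \<bar>i\<bar>))"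

lemma enc_bool_inject [simp]: "enc_bool a = enc_bool b \<longleftrightarrow> a = b"
  by (simp add: enc_bool_def)

lemma enc_list_inject:
  "(\<And>x y. x \<in> set xs \<Longrightarrow> f x = f y \<longleftrightarrow> x = y) \<Longrightarrow> enc_list f xs = enc_list f ys \<longleftrightarrow> xs = ys"
proof (induction xs arbitrary: ys)
  case Nil
  then show ?case by (cases ys) auto
next
  case (Cons x xs)
  then show ?case by (cases ys) auto
qed

lemma enc_unary_inject [simp]: "enc_unary m = enc_unary n \<longleftrightarrow> m = n"
  unfolding enc_unary_def by (subst enc_list_inject) (auto dest: arg_cong[where f = length])

lemma enc_binary_inject [simp]: "enc_binary m = enc_binary n \<longleftrightarrow> m = n"
proof (induction m arbitrary: n rule: less_induct)
  case (less m)
  show ?case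
  proof (cases "m = 0 \<or> n = 0")
    case True
    then show ?thesis by (auto simp: enc_binary.simps[of m] enc_binary.simps[of n])
  next
    case False
    then have "enc_binary m = enc_binary n \<longleftrightarrow>
        (odd m = odd n) \<and> m div 2 = n div 2"
      using less[of "m div 2" "n div 2"]
      by (auto simp: enc_binary.simps[of m] enc_binary.simps[of n])
    also have "\<dots> \<longleftrightarrow> m = n" by presburger
    finally show ?thesis .
  qed
qed

lemma enc_int_inject [simp]: "enc_int i = enc_int j \<longleftrightarrow> i = j"
  by (auto simp: enc_int_def)


section \<open>Weighted Max-\<open>k\<close>-SAT\<close>

text \<open>A literal \<open>(b, i)\<close> is the variable \<open>i\<close> if \<open>b\<close> and its negation otherwise; the
  variables of an instance are \<open>0, \<dots>, n - 1\<close>. The clauses of a formula form a list, each paired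
  with its weight.\<close>

type_synonym literal = "bool \<times> nat"
type_synonym clause = "literal list"

record wcnf =
  num_vars :: nat
  clauses :: "(clause \<times> nat) list"
  threshold :: nat

definition num_clauses :: "wcnf \<Rightarrow> nat" where
  "num_clauses I = length (clauses I)"

definition weighted_max_ksat :: "nat \<Rightarrow> wcnf set" where
  "weighted_max_ksat k = {I. \<forall>(C, w) \<in> set (clauses I).
     length C = k \<and> (\<forall>(b, i) \<in> set C. i < num_vars I) \<and> w > 0}"

definition max_ksat :: "nat \<Rightarrow> wcnf set" where
  "max_ksat k = {I \<in> weighted_max_ksat k. \<forall>(C, w) \<in> set (clauses I). w = 1}"

definition satisfies :: "(nat \<Rightarrow> bool) \<Rightarrow> clause \<Rightarrow> bool" where
  "satisfies a C \<longleftrightarrow> (\<exists>(b, i) \<in> set C. a i = b)"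

definition satisfied_weight :: "(nat \<Rightarrow> bool) \<Rightarrow> wcnf \<Rightarrow> nat" where
  "satisfied_weight a I = (\<Sum>(C, w) \<leftarrow> clauses I. if satisfies a C then w else 0)"

definition max_sat_yes :: "wcnf \<Rightarrow> bool" where
  "max_sat_yes I \<longleftrightarrow> (\<exists>a. satisfied_weight a I \<ge> threshold I)"

text \<open>Weights and the threshold are written in binary. The number of variables is written in
  unary, so that the input length is at least \<open>n\<close>.\<close>

definition enc_literal :: "literal \<Rightarrow> tree" where
  "enc_literal l = Node (enc_bool (fst l)) (enc_unary (snd l))"

definition enc_weighted_clause :: "clause \<times> nat \<Rightarrow> tree" where
  "enc_weighted_clause c = Node (enc_list enc_literal (fst c)) (enc_binary (snd c))"

definition enc_wcnf :: "wcnf \<Rightarrow> tree" where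
  "enc_wcnf I = Node (enc_unary (num_vars I))
     (Node (enc_list enc_weighted_clause (clauses I)) (enc_binary (threshold I)))"

lemma enc_literal_inject [simp]: "enc_literal l = enc_literal l' \<longleftrightarrow> l = l'"
  by (auto simp: enc_literal_def prod_eq_iff)

lemma enc_weighted_clause_inject [simp]:
  "enc_weighted_clause c = enc_weighted_clause c' \<longleftrightarrow> c = c'"
  by (auto simp: enc_weighted_clause_def prod_eq_iff enc_list_inject)

lemma inj_enc_wcnf: "inj enc_wcnf"
  by (auto intro!: injI wcnf.equality simp: enc_wcnf_def enc_list_inject)


section \<open>The closest vector problem\<close>

definition lp_norm :: "real \<Rightarrow> real vec \<Rightarrow> real" where
  "lp_norm p x = (\<Sum>i<dim_vec x. \<bar>x $ i\<bar> powr p) powr (1 / p)"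

definition lin_indep_cols :: "real mat \<Rightarrow> bool" where
  "lin_indep_cols B \<longleftrightarrow>
     (\<forall>x \<in> carrier_vec (dim_col B). B *\<^sub>v x = 0\<^sub>v (dim_row B) \<longrightarrow> x = 0\<^sub>v (dim_col B))"

definition lattice_of :: "real mat \<Rightarrow> real vec set" where
  "lattice_of B = {B *\<^sub>v map_vec real_of_int z | z. z \<in> carrier_vec (dim_col B)}"

text \<open>An instance of rank \<open>N\<close>; the ambient dimension \<open>d\<close> is \<open>dim_row B\<close>.\<close>

definition cvp_instance :: "nat \<Rightarrow> real mat \<Rightarrow> real vec \<Rightarrow> real \<Rightarrow> bool" where
  "cvp_instance N B t r \<longleftrightarrow>
     dim_col B = N \<and> lin_indep_cols B \<and> t \<in> carrier_vec (dim_row B) \<and> r > 0"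

text \<open>The minimum is required to be attained, as \<open>min\<close> says (rather than being an infimum).\<close>

definition cvp_yes :: "real \<Rightarrow> real mat \<Rightarrow> real vec \<Rightarrow> real \<Rightarrow> bool" where
  "cvp_yes p B t r \<longleftrightarrow>
     (\<exists>x. is_arg_min (\<lambda>x. lp_norm p (x - t)) (\<lambda>x. x \<in> lattice_of B) x \<and> lp_norm p (x - t) \<le> r)"


section \<open>Finite descriptions of real CVP instances\<close>

text \<open>
  The numbers in an instance of CVP in the \<open>p\<close>-norm are real: already the \<open>p\<close>-th root of a
  weight is irrational in general, and \<open>p\<close> may be any real number, computable or not. A
  machine writes such numbers as closed expressions built from binary integers by the field
  operations, \<open>p\<close>-th powers and \<open>p\<close>-th roots. The exponent \<open>p\<close> is a parameter of the target
  problem and not part of the expression. Powers and roots are those of the absolute value,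
  which makes every expression denote a real number; division by \<open>0\<close> gives \<open>0\<close>.
\<close>

datatype rexpr =
    Const int
  | Add rexpr rexpr
  | Sub rexpr rexpr
  | Mul rexpr rexpr
  | Div rexpr rexpr
  | PPow rexpr
  | PRoot rexpr

fun val :: "real \<Rightarrow> rexpr \<Rightarrow> real" where
  "val p (Const i) = real_of_int i"
| "val p (Add a b) = val p a + val p b"
| "val p (Sub a b) = val p a - val p b"
| "val p (Mul a b) = val p a * val p b"
| "val p (Div a b) = val p a / val p b"
| "val p (PPow a) = \<bar>val p a\<bar> powr p"
| "val p (PRoot a) = \<bar>val p a\<bar> powr (1 / p)"

fun enc_rexpr :: "rexpr \<Rightarrow> tree" where
  "enc_rexpr (Const i) = Node (enc_unary 0) (enc_int i)"
| "enc_rexpr (Add a b) = Node (enc_unary 1) (Node (enc_rexpr a) (enc_rexpr b))"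
| "enc_rexpr (Sub a b) = Node (enc_unary 2) (Node (enc_rexpr a) (enc_rexpr b))"
| "enc_rexpr (Mul a b) = Node (enc_unary 3) (Node (enc_rexpr a) (enc_rexpr b))"
| "enc_rexpr (Div a b) = Node (enc_unary 4) (Node (enc_rexpr a) (enc_rexpr b))"
| "enc_rexpr (PPow a) = Node (enc_unary 5) (enc_rexpr a)"
| "enc_rexpr (PRoot a) = Node (enc_unary 6) (enc_rexpr a)"

lemma enc_rexpr_inject [simp]: "enc_rexpr a = enc_rexpr b \<longleftrightarrow> a = b"
proof (induction a arbitrary: b)
  case (Const i) then show ?case by (cases b) auto
next
  case (Add a1 a2) then show ?case by (cases b) auto
next
  case (Sub a1 a2) then show ?case by (cases b) auto
next
  case (Mul a1 a2) then show ?case by (cases b) auto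
next
  case (Div a1 a2) then show ?case by (cases b) auto
next
  case (PPow a) then show ?case by (cases b) auto
next
  case (PRoot a) then show ?case by (cases b) auto
qed

record cvp_desc =
  desc_rank :: nat
  desc_rows :: "rexpr list list"
  desc_target :: "rexpr list"
  desc_radius :: rexpr

definition well_shaped :: "cvp_desc \<Rightarrow> bool" where
  "well_shaped J \<longleftrightarrow> (\<forall>row \<in> set (desc_rows J). length row = desc_rank J)"

definition desc_basis :: "real \<Rightarrow> cvp_desc \<Rightarrow> real mat" where
  "desc_basis p J = mat_of_rows_list (desc_rank J) (map (map (val p)) (desc_rows J))"

definition desc_vec :: "real \<Rightarrow> cvp_desc \<Rightarrow> real vec" where
  "desc_vec p J = vec_of_list (map (val p) (desc_target J))"

definition desc_r :: "real \<Rightarrow> cvp_desc \<Rightarrow> real" where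
  "desc_r p J = val p (desc_radius J)"

definition enc_cvp_desc :: "cvp_desc \<Rightarrow> tree" where
  "enc_cvp_desc J = Node (enc_unary (desc_rank J)) (Node (enc_list (enc_list enc_rexpr) (desc_rows J))
     (Node (enc_list enc_rexpr (desc_target J)) (enc_rexpr (desc_radius J))))"

lemma inj_enc_cvp_desc: "inj enc_cvp_desc"
  by (auto intro!: injI cvp_desc.equality simp: enc_cvp_desc_def enc_list_inject)

end

theory Submission
  imports Defs "HOL-Library.More_List"
begin

text \<open>
  Let \<open>A\<close> be \<open>1\<close> plus the total weight. The coordinates of a lattice point minus the target
  are \<open>A\<^bsup>1/p\<^esup> (2 z\<^sub>i - 1)\<close> for all \<open>i\<close> and \<open>w\<^bsup>1/p\<^esup> (2 (s - y) - 3)\<close> for each clause of weight \<open>w\<close>,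
  where \<open>s\<close> is its number of true literals and \<open>y\<close> the sum of its \<open>k - 2\<close> auxiliary variables.
  The first kind forces \<open>z\<close> to be binary, as a single other value costs more than any choice of
  assignment can save. Since \<open>1 \<le> s \<le> k\<close> allows \<open>s - y \<in> {1, 2}\<close> and \<open>s = 0\<close> does not, a clause
  costs at least \<open>w\<close> if it is satisfied and at least \<open>3\<^sup>p w\<close> otherwise, and these values are attained.

  For the running time, the functions computable in polynomial time are closed under composition,
  pairing, case distinction and folds over lists whose accumulator grows by a controlled amount.
  Since entries are written as expressions, the reduction performs no arithmetic on weights.
\<close>

section \<open>Polynomial-time functions on trees\<close>

lemma poly_nat_mono: "x \<le> y \<Longrightarrow> poly p x \<le> poly p y" for p :: "nat poly"
  by (induction p) (auto intro!: add_mono mult_mono)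

lemma tree_size_pos [simp]: "tree_size t > 0"
  by (cases t) auto

lemma tree_size_hd_le: "tree_size (hd_tree t) \<le> tree_size t"
  by (cases t) auto

lemma tree_size_tl_le: "tree_size (tl_tree t) \<le> tree_size t"
  by (cases t) auto

text \<open>The base variable \<open>b\<close> holds input and output; a program may overwrite any variable above \<open>b\<close>,
  whatever its initial content, but none below. So running a subprogram at a larger base keeps
  the variables of the caller.\<close>

definition runs :: "com \<Rightarrow> nat \<Rightarrow> (tree \<Rightarrow> tree) \<Rightarrow> nat poly \<Rightarrow> bool" where
  "runs c b f q \<longleftrightarrow> (\<forall>s. \<exists>t s'. exec c s t s' \<and> s' b = f (s b) \<and> (\<forall>v<b. s' v = s v) \<and>
     t + tree_size (f (s b)) \<le> poly q (tree_size (s b)))"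

text \<open>The polynomial is chosen before the base, so a combinator can move a subprogram to a
  shifted base without affecting the bound. Since \<open>runs\<close> bounds the output size along
  with the time, such bounds compose.\<close>

definition tree_ptime :: "(tree \<Rightarrow> tree) \<Rightarrow> bool" where
  "tree_ptime f \<longleftrightarrow> (\<exists>q. \<forall>b. \<exists>c. runs c b f q)"

lemma runsE:
  assumes "runs c b f q"
  obtains t s' where "exec c s t s'" "s' b = f (s b)" "\<And>v. v < b \<Longrightarrow> s' v = s v"
    "t + tree_size (f (s b)) \<le> poly q (tree_size (s b))"
  using assms unfolding runs_def by blast

section \<open>Basic tree functions, composition, pairing and case distinction\<close>

lemma tree_ptime_id: "tree_ptime (\<lambda>x. x)"
proof -
  have "runs Skip b (\<lambda>x. x) [:1, 1:]" for b
    unfolding runs_def by (force intro: exec_Skip)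
  then show ?thesis unfolding tree_ptime_def by blast
qed

lemma tree_ptime_Leaf: "tree_ptime (\<lambda>_. Leaf)"
proof -
  have "runs (Assign b LeafE) b (\<lambda>_. Leaf) [:3:]" for b
    unfolding runs_def
  proof
    fix s
    show "\<exists>t s'. exec (Assign b LeafE) s t s' \<and> s' b = Leaf \<and> (\<forall>v<b. s' v = s v) \<and>
      t + tree_size Leaf \<le> poly [:3:] (tree_size (s b))"
      by (rule exI, rule exI, rule conjI, rule exec_Assign) auto
  qed
  then show ?thesis unfolding tree_ptime_def by blast
qed

lemma tree_ptime_hd_tree: "tree_ptime hd_tree"
proof -
  have "runs (Assign b (HdE (Var b))) b hd_tree [:2, 2:]" for b
    unfolding runs_def
  proof
    fix s
    show "\<exists>t s'. exec (Assign b (HdE (Var b))) s t s' \<and> s' b = hd_tree (s b) \<and> (\<forall>v<b. s' v = s v) \<and>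
      t + tree_size (hd_tree (s b)) \<le> poly [:2, 2:] (tree_size (s b))"
      by (rule exI, rule exI, rule conjI, rule exec_Assign) (use tree_size_hd_le in auto)
  qed
  then show ?thesis unfolding tree_ptime_def by blast
qed

lemma tree_ptime_tl_tree: "tree_ptime tl_tree"
proof -
  have "runs (Assign b (TlE (Var b))) b tl_tree [:2, 2:]" for b
    unfolding runs_def
  proof
    fix s
    show "\<exists>t s'. exec (Assign b (TlE (Var b))) s t s' \<and> s' b = tl_tree (s b) \<and> (\<forall>v<b. s' v = s v) \<and>
      t + tree_size (tl_tree (s b)) \<le> poly [:2, 2:] (tree_size (s b))"
      by (rule exI, rule exI, rule conjI, rule exec_Assign) (use tree_size_tl_le in auto)
  qed
  then show ?thesis unfolding tree_ptime_def by blast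
qed

lemma tree_ptime_comp:
  assumes "tree_ptime g" "tree_ptime f"
  shows "tree_ptime (\<lambda>x. g (f x))"
proof -
  obtain qg where qg: "\<And>b. \<exists>c. runs c b g qg" using assms(1) unfolding tree_ptime_def by blast
  obtain qf where qf: "\<And>b. \<exists>c. runs c b f qf" using assms(2) unfolding tree_ptime_def by blast
  have "\<exists>c. runs c b (\<lambda>x. g (f x)) (qf + pcompose qg qf)" for b
  proof -
    obtain cf cg where cf: "runs cf b f qf" and cg: "runs cg b g qg" using qf qg by blast
    have "runs (Seq cf cg) b (\<lambda>x. g (f x)) (qf + pcompose qg qf)"
      unfolding runs_def
    proof
      fix s
      obtain t1 s1 where 1: "exec cf s t1 s1" "s1 b = f (s b)" "\<And>v. v < b \<Longrightarrow> s1 v = s v"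
        "t1 + tree_size (f (s b)) \<le> poly qf (tree_size (s b))" by (rule runsE[OF cf, where s = s]) (rule that)
      obtain t2 s2 where 2: "exec cg s1 t2 s2" "s2 b = g (s1 b)" "\<And>v. v < b \<Longrightarrow> s2 v = s1 v"
        "t2 + tree_size (g (s1 b)) \<le> poly qg (tree_size (s1 b))" by (rule runsE[OF cg, where s = s1]) (rule that)
      \<comment> \<open>The bound on the output of \<open>f\<close> also limits the input of
        \<open>g\<close>, and polynomials over the naturals are monotone.\<close>
      have le: "poly qg (tree_size (f (s b))) \<le> poly qg (poly qf (tree_size (s b)))"
        using 1(4) by (intro poly_nat_mono) simp
      show "\<exists>t s'. exec (Seq cf cg) s t s' \<and> s' b = g (f (s b)) \<and> (\<forall>v<b. s' v = s v) \<and>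
        t + tree_size (g (f (s b))) \<le> poly (qf + pcompose qg qf) (tree_size (s b))"
        by (intro exI conjI, (rule exec_Seq 1(1) 2(1))+) (use 1 2 le in \<open>auto simp: poly_pcompose\<close>)
    qed
    then show ?thesis ..
  qed
  then show ?thesis unfolding tree_ptime_def by blast
qed

lemma tree_ptime_Node:
  assumes "tree_ptime f" "tree_ptime g"
  shows "tree_ptime (\<lambda>x. Node (f x) (g x))"
proof -
  obtain qf where qf: "\<And>b. \<exists>c. runs c b f qf" using assms(1) unfolding tree_ptime_def by blast
  obtain qg where qg: "\<And>b. \<exists>c. runs c b g qg" using assms(2) unfolding tree_ptime_def by blast
  \<comment> \<open>\<open>qf\<close> and \<open>qg\<close> occur twice: the last assignment reads
    both results, and the output contains them once more.\<close>
  let ?q = "[:5, 2:] + qf + qf + qg + qg"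
  have "\<exists>c. runs c b (\<lambda>x. Node (f x) (g x)) ?q" for b
  proof -
    \<comment> \<open>Base \<open>b + 1\<close> keeps the input in \<open>b\<close> available for
      \<open>g\<close>, and base \<open>b + 2\<close> also protects the result of
      \<open>f\<close>.\<close>
    obtain cf cg where cf: "runs cf (b + 1) f qf" and cg: "runs cg (b + 2) g qg"
      using qf qg by blast
    let ?c = "Seq (Assign (b + 1) (Var b)) (Seq cf (Seq (Assign (b + 2) (Var b)) (Seq cg
      (Assign b (NodeE (Var (b + 1)) (Var (b + 2)))))))"
    have "runs ?c b (\<lambda>x. Node (f x) (g x)) ?q"
      unfolding runs_def
    proof
      fix s
      let ?s0 = "s(b + 1 := eval_exp (Var b) s)"
      obtain t1 s1 where 1: "exec cf ?s0 t1 s1" "s1 (b + 1) = f (?s0 (b + 1))"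
        "\<And>v. v < b + 1 \<Longrightarrow> s1 v = ?s0 v"
        "t1 + tree_size (f (?s0 (b + 1))) \<le> poly qf (tree_size (?s0 (b + 1)))"
        by (rule runsE[OF cf, where s = ?s0]) (rule that)
      let ?s1 = "s1(b + 2 := eval_exp (Var b) s1)"
      obtain t2 s2 where 2: "exec cg ?s1 t2 s2" "s2 (b + 2) = g (?s1 (b + 2))"
        "\<And>v. v < b + 2 \<Longrightarrow> s2 v = ?s1 v"
        "t2 + tree_size (g (?s1 (b + 2))) \<le> poly qg (tree_size (?s1 (b + 2)))"
        by (rule runsE[OF cg, where s = ?s1]) (rule that)
      show "\<exists>t s'. exec ?c s t s' \<and> s' b = Node (f (s b)) (g (s b)) \<and> (\<forall>v<b. s' v = s v) \<and>
        t + tree_size (Node (f (s b)) (g (s b))) \<le> poly ?q (tree_size (s b))"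
        by (intro exI conjI, (rule exec_Seq exec_Assign 1(1) 2(1))+) (use 1 2 in auto)
    qed
    then show ?thesis ..
  qed
  then show ?thesis unfolding tree_ptime_def by blast
qed

lemma tree_ptime_If:
  assumes "tree_ptime f" "tree_ptime g" "tree_ptime h"
  shows "tree_ptime (\<lambda>x. if f x = Leaf then g x else h x)"
proof -
  obtain qf where qf: "\<And>b. \<exists>c. runs c b f qf" using assms(1) unfolding tree_ptime_def by blast
  obtain qg where qg: "\<And>b. \<exists>c. runs c b g qg" using assms(2) unfolding tree_ptime_def by blast
  obtain qh where qh: "\<And>b. \<exists>c. runs c b h qh" using assms(3) unfolding tree_ptime_def by blast
  let ?q = "[:2, 1:] + qf + qg + qh"
  have "\<exists>c. runs c b (\<lambda>x. if f x = Leaf then g x else h x) ?q" for b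
  proof -
    \<comment> \<open>The test runs on a copy at \<open>b + 1\<close>, so that the chosen branch
      still finds the input in \<open>b\<close>.\<close>
    obtain cf cg ch where cf: "runs cf (b + 1) f qf" and cg: "runs cg b g qg"
      and ch: "runs ch b h qh"
      using qf qg qh by blast
    let ?c = "Seq (Assign (b + 1) (Var b)) (Seq cf (Cond (Var (b + 1)) ch cg))"
    have "runs ?c b (\<lambda>x. if f x = Leaf then g x else h x) ?q"
      unfolding runs_def
    proof
      fix s
      let ?s0 = "s(b + 1 := eval_exp (Var b) s)"
      obtain t1 s1 where 1: "exec cf ?s0 t1 s1" "s1 (b + 1) = f (?s0 (b + 1))"
        "\<And>v. v < b + 1 \<Longrightarrow> s1 v = ?s0 v"
        "t1 + tree_size (f (?s0 (b + 1))) \<le> poly qf (tree_size (?s0 (b + 1)))"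
        by (rule runsE[OF cf, where s = ?s0]) (rule that)
      obtain t2 s2 where 2: "exec cg s1 t2 s2" "s2 b = g (s1 b)"
        "\<And>v. v < b \<Longrightarrow> s2 v = s1 v"
        "t2 + tree_size (g (s1 b)) \<le> poly qg (tree_size (s1 b))"
        by (rule runsE[OF cg, where s = s1]) (rule that)
      obtain t3 s3 where 3: "exec ch s1 t3 s3" "s3 b = h (s1 b)"
        "\<And>v. v < b \<Longrightarrow> s3 v = s1 v"
        "t3 + tree_size (h (s1 b)) \<le> poly qh (tree_size (s1 b))"
        by (rule runsE[OF ch, where s = s1]) (rule that)
      show "\<exists>t s'. exec ?c s t s' \<and> s' b = (if f (s b) = Leaf then g (s b) else h (s b)) \<and>
        (\<forall>v<b. s' v = s v) \<and>
        t + tree_size (if f (s b) = Leaf then g (s b) else h (s b)) \<le> poly ?q (tree_size (s b))"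
      proof (cases "f (s b) = Leaf")
        case True
        have "eval_exp (Var (b + 1)) s1 = Leaf" using True 1(2) by simp
        note e = exec_CondFalse[OF this 2(1)]
        show ?thesis
          by (intro exI conjI, (rule exec_Seq exec_Assign 1(1) e)+) (use 1 2 True in auto)
      next
        case False
        have "eval_exp (Var (b + 1)) s1 \<noteq> Leaf" using False 1(2) by simp
        note e = exec_CondTrue[OF this 3(1)]
        show ?thesis
          by (intro exI conjI, (rule exec_Seq exec_Assign 1(1) e)+) (use 1 3 False in auto)
      qed
    qed
    then show ?thesis ..
  qed
  then show ?thesis unfolding tree_ptime_def by blast
qed

section \<open>Folds over lists\<close>

text \<open>A tree is read as a list along its right spine. The parameter \<open>c\<close> replaces
  the environment that a step function would otherwise capture, as a step is a program acting on one
  tree.\<close>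

fun tfold :: "(tree \<Rightarrow> tree \<Rightarrow> tree \<Rightarrow> tree) \<Rightarrow> tree \<Rightarrow> tree \<Rightarrow> tree \<Rightarrow> tree" where
  "tfold g c Leaf a = a"
| "tfold g c (Node h t) a = tfold g c t (g c h a)"

lemma tree_size_tfold_le:
  assumes "\<And>h a. tree_size h \<le> L \<Longrightarrow> tree_size (g c h a) \<le> tree_size a + G"
  shows "tree_size l \<le> L \<Longrightarrow> tree_size (tfold g c l a) \<le> tree_size a + tree_size l * G"
proof (induction l arbitrary: a)
  case (Node h t)
  have "tree_size (tfold g c t (g c h a)) \<le> tree_size (g c h a) + tree_size t * G"
    using Node by auto
  also have "\<dots> \<le> tree_size a + G + tree_size t * G"
    using assms[of h a] Node.prems by simp
  finally show ?case by (simp add: algebra_simps)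
qed simp

text \<open>The variables above \<open>b\<close> hold the parameter, the remaining list, the
  accumulator and the argument of the step, in this order. \<open>M\<close> bounds the accumulator
  together with all growth still to come, and \<open>T\<close> bounds the time of one
  iteration.\<close>

lemma exec_tfold_loop:
  fixes b L M C G :: nat and cg :: com and q :: "nat poly"
  defines "W \<equiv> While (Var (b + 2))
     (Seq (Assign (b + 4) (NodeE (Var (b + 1)) (NodeE (HdE (Var (b + 2))) (Var (b + 3)))))
     (Seq cg (Seq (Assign (b + 3) (Var (b + 4))) (Assign (b + 2) (TlE (Var (b + 2)))))))"
  assumes cg: "runs cg (b + 4) (\<lambda>x. g (hd_tree x) (hd_tree (tl_tree x)) (tl_tree (tl_tree x))) q"
    and growth: "\<And>h a. tree_size h \<le> L \<Longrightarrow> tree_size (g c h a) \<le> tree_size a + G"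
    and C: "tree_size c \<le> C"
    and T: "T = 9 + 3 * L + C + 2 * M + poly q (2 + C + L + M)"
  shows "tree_size l \<le> L \<Longrightarrow> tree_size a + tree_size l * G \<le> M \<Longrightarrow>
     s (b + 1) = c \<Longrightarrow> s (b + 2) = l \<Longrightarrow> s (b + 3) = a \<Longrightarrow>
     \<exists>t s'. exec W s t s' \<and> s' (b + 3) = tfold g c l a \<and> (\<forall>v\<le>b. s' v = s v) \<and> t \<le> tree_size l * T"
proof (induction l arbitrary: a s)
  case Leaf
  have "eval_exp (Var (b + 2)) s = Leaf" using Leaf by simp
  note e = exec_WhileFalse[OF this]
  show ?case unfolding W_def
    by (intro exI conjI, rule e) (use Leaf in \<open>auto simp: T\<close>)
next
  case (Node h l)
  have ne: "eval_exp (Var (b + 2)) s \<noteq> Leaf" using Node.prems by simp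
  let ?s0 = "s(b + 4 := eval_exp (NodeE (Var (b + 1)) (NodeE (HdE (Var (b + 2))) (Var (b + 3)))) s)"
  obtain t1 s1 where 1: "exec cg ?s0 t1 s1" "s1 (b + 4) = g c h a"
    "\<And>v. v < b + 4 \<Longrightarrow> s1 v = s v"
    "t1 + tree_size (g c h a) \<le> poly q (2 + tree_size c + tree_size h + tree_size a)"
    by (rule runsE[OF cg, where s = ?s0]) (use Node.prems in \<open>auto simp: algebra_simps\<close>)
  let ?s2 = "s1(b + 3 := eval_exp (Var (b + 4)) s1)"
  let ?s3 = "?s2(b + 2 := eval_exp (TlE (Var (b + 2))) ?s2)"
  \<comment> \<open>The growth \<open>G\<close> of this step is paid for by the shrinking of the
    list, so the bound \<open>M\<close> is preserved.\<close>
  have sz: "tree_size (g c h a) + tree_size l * G \<le> M"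
    using growth[of h a] Node.prems(1,2) by (simp add: algebra_simps)
  have "\<exists>t s'. exec W ?s3 t s' \<and> s' (b + 3) = tfold g c l (g c h a) \<and> (\<forall>v\<le>b. s' v = ?s3 v) \<and>
      t \<le> tree_size l * T"
    by (rule Node.IH(2)) (use Node.prems sz 1 in auto)
  then obtain t2 s' where 2: "exec W ?s3 t2 s'" "s' (b + 3) = tfold g c l (g c h a)"
    "\<And>v. v \<le> b \<Longrightarrow> s' v = ?s3 v" "t2 \<le> tree_size l * T"
    by blast
  have aM: "tree_size a \<le> M" and gM: "tree_size (g c h a) \<le> M" using Node.prems(2) sz by auto
  have "poly q (2 + tree_size c + tree_size h + tree_size a) \<le> poly q (2 + C + L + M)"
    using C Node.prems(1) aM by (intro poly_nat_mono) auto
  then have t1: "t1 \<le> poly q (2 + C + L + M)" using 1(4) by linarith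
  \<comment> \<open>With this product kept opaque, the final estimate is linear.\<close>
  define K where "K = tree_size (Node h l) * T"
  have K: "T + tree_size l * T \<le> K"
    unfolding K_def by (simp add: algebra_simps)
  have T': "9 + 3 * L + C + 2 * M + poly q (2 + C + L + M) \<le> T"
    using T by simp
  note 2(1)[unfolded W_def]
  note e = exec_WhileTrue[OF ne _ this]
  show ?case unfolding W_def K_def[symmetric]
  proof (intro exI conjI, (rule e exec_Seq exec_Assign 1(1))+)
    show "s' (b + 3) = tfold g c (Node h l) a" using 2(2) by simp
    show "\<forall>v\<le>b. s' v = s v" using 1(3) 2(3) by simp
  next
    have s1: "s1 (b + 2) = Node h l" using 1(3) Node.prems(4) by simp
    have hl: "1 + tree_size h + tree_size l \<le> L" using Node.prems(1) by simp
    show "1 + exp_cost (Var (b + 2)) s +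
        (1 + exp_cost (NodeE (Var (b + 1)) (NodeE (HdE (Var (b + 2))) (Var (b + 3)))) s +
         (t1 + (1 + exp_cost (Var (b + 4)) s1 + (1 + exp_cost (TlE (Var (b + 2))) ?s2)))) + t2 \<le> K"
      (is "?t \<le> K")
    proof -
      have "?t = 8 + 3 * (1 + tree_size h + tree_size l) + tree_size c + tree_size a +
          tree_size (g c h a) + t1 + t2"
        by (simp add: 1(2) s1[simplified] Node.prems(3-5)[simplified])
      also have "\<dots> \<le> 8 + 3 * L + C + M + M + poly q (2 + C + L + M) + tree_size l * T"
        by (intro add_mono mult_le_mono2 order_refl hl C aM gM t1 2(4))
      finally show ?thesis using K T' by linarith
    qed
  qed
qed

text \<open>One step enlarges the accumulator by an amount that does not depend on the accumulator.
  Without this the size of the result could be exponential in the number of steps.\<close>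

lemma tree_ptime_tfold_raw:
  assumes g: "tree_ptime (\<lambda>x. g (hd_tree x) (hd_tree (tl_tree x)) (tl_tree (tl_tree x)))"
    and growth: "\<And>c h a. tree_size (g c h a) \<le> tree_size a + poly P (tree_size c + tree_size h)"
  shows "tree_ptime (\<lambda>x. tfold g (hd_tree x) (hd_tree (tl_tree x)) (tl_tree (tl_tree x)))"
proof -
  obtain q where q: "\<And>b. \<exists>c. runs c b (\<lambda>x. g (hd_tree x) (hd_tree (tl_tree x)) (tl_tree (tl_tree x))) q"
    using g unfolding tree_ptime_def by blast
  let ?X = "[:0, 1:] :: nat poly"
  \<comment> \<open>The parameter and each list element are no larger than the input, hence the
    argument \<open>[:0, 2:]\<close>; the input size also bounds the number of steps.\<close>
  let ?M = "?X + ?X * pcompose P [:0, 2:]"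
  let ?T = "9 + 4 * ?X + 2 * ?M + pcompose q (2 + 2 * ?X + ?M)"
  let ?q = "11 + 4 * ?X + 2 * ?M + ?X * ?T"
  have "\<exists>c. runs c b (\<lambda>x. tfold g (hd_tree x) (hd_tree (tl_tree x)) (tl_tree (tl_tree x))) ?q" for b
  proof -
    obtain cg where cg: "runs cg (b + 4) (\<lambda>x. g (hd_tree x) (hd_tree (tl_tree x)) (tl_tree (tl_tree x))) q"
      using q by blast
    let ?W = "While (Var (b + 2))
     (Seq (Assign (b + 4) (NodeE (Var (b + 1)) (NodeE (HdE (Var (b + 2))) (Var (b + 3)))))
     (Seq cg (Seq (Assign (b + 3) (Var (b + 4))) (Assign (b + 2) (TlE (Var (b + 2)))))))"
    let ?c = "Seq (Assign (b + 1) (HdE (Var b))) (Seq (Assign (b + 2) (HdE (TlE (Var b))))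
      (Seq (Assign (b + 3) (TlE (TlE (Var b)))) (Seq ?W (Assign b (Var (b + 3))))))"
    have R: "runs ?c b (\<lambda>x. tfold g (hd_tree x) (hd_tree (tl_tree x)) (tl_tree (tl_tree x))) ?q"
      unfolding runs_def
    proof
      fix s :: store
      define x where "x = s b"
      define c where "c = hd_tree x"
      define l where "l = hd_tree (tl_tree x)"
      define a where "a = tl_tree (tl_tree x)"
      define n where "n = tree_size x"
      define M where "M = n + n * poly P (n + n)"
      define T where "T = 9 + 3 * n + n + 2 * M + poly q (2 + n + n + M)"
      have cn: "tree_size c \<le> n" and ln: "tree_size l \<le> n" and an: "tree_size a \<le> n"
        unfolding c_def l_def a_def n_def
        by (meson tree_size_hd_le tree_size_tl_le order_trans)+
      have gr: "tree_size (g c h a) \<le> tree_size a + poly P (n + n)" if "tree_size h \<le> n" for h a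
      proof -
        have "poly P (tree_size c + tree_size h) \<le> poly P (n + n)"
          using that cn by (intro poly_nat_mono) simp
        then show ?thesis using growth[of c h a] by linarith
      qed
      have lM: "tree_size a + tree_size l * poly P (n + n) \<le> M"
        unfolding M_def using an ln by (intro add_mono mult_mono) auto
      let ?s1 = "s(b + 1 := eval_exp (HdE (Var b)) s)"
      let ?s2 = "?s1(b + 2 := eval_exp (HdE (TlE (Var b))) ?s1)"
      let ?s3 = "?s2(b + 3 := eval_exp (TlE (TlE (Var b))) ?s2)"
      have "\<exists>t s'. exec ?W ?s3 t s' \<and> s' (b + 3) = tfold g c l a \<and> (\<forall>v\<le>b. s' v = ?s3 v) \<and>
          t \<le> tree_size l * T"
        by (rule exec_tfold_loop[OF cg gr cn T_def ln lM]) (simp_all add: c_def l_def a_def x_def)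
      then obtain t s' where W: "exec ?W ?s3 t s'" "s' (b + 3) = tfold g c l a"
        "\<And>v. v \<le> b \<Longrightarrow> s' v = ?s3 v" "t \<le> tree_size l * T"
        by blast
      have tn: "t \<le> n * T" using W(4) ln by (meson mult_le_mono1 order_trans)
      have fM: "tree_size (tfold g c l a) \<le> M"
        by (rule order_trans[OF tree_size_tfold_le lM]) (use gr ln in auto)
      have pq: "poly ?q (tree_size x) = 11 + 4 * n + 2 * M + n * T"
        unfolding T_def M_def n_def
        by (simp add: poly_pcompose numeral_poly algebra_simps)
      show "\<exists>t s'. exec ?c s t s' \<and>
          s' b = tfold g (hd_tree (s b)) (hd_tree (tl_tree (s b))) (tl_tree (tl_tree (s b))) \<and>
          (\<forall>v<b. s' v = s v) \<and>
          t + tree_size (tfold g (hd_tree (s b)) (hd_tree (tl_tree (s b))) (tl_tree (tl_tree (s b))))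
          \<le> poly ?q (tree_size (s b))"
        unfolding pq x_def[symmetric] c_def[symmetric] l_def[symmetric] a_def[symmetric]
      proof (intro exI conjI, (rule exec_Seq exec_Assign W(1))+)
        show "1 + exp_cost (HdE (Var b)) s + (1 + exp_cost (HdE (TlE (Var b))) ?s1 +
            (1 + exp_cost (TlE (TlE (Var b))) ?s2 + (t + (1 + exp_cost (Var (b + 3)) s')))) +
            tree_size (tfold g c l a) \<le> 11 + 4 * n + 2 * M + n * T" (is "?t \<le> _")
        proof -
          have "?t = 9 + 3 * n + t + 2 * tree_size (tfold g c l a)"
            by (simp add: W(2)[simplified] n_def x_def)
          then show ?thesis using tn fM by linarith
        qed
      qed (use W(2,3) in auto)
    qed
    show ?thesis by (intro exI) (rule R)
  qed
  then show ?thesis unfolding tree_ptime_def by blast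
qed

lemma tree_ptime_hd: "tree_ptime f \<Longrightarrow> tree_ptime (\<lambda>x. hd_tree (f x))"
  by (rule tree_ptime_comp[OF tree_ptime_hd_tree])

lemma tree_ptime_tl: "tree_ptime f \<Longrightarrow> tree_ptime (\<lambda>x. tl_tree (f x))"
  by (rule tree_ptime_comp[OF tree_ptime_tl_tree])

lemma tree_ptime_const: "tree_ptime (\<lambda>_. t)"
  by (induction t) (auto intro: tree_ptime_Leaf tree_ptime_Node)

lemmas tree_ptime_intros =
  tree_ptime_id tree_ptime_const tree_ptime_hd tree_ptime_tl tree_ptime_Node tree_ptime_If

lemma tree_ptime_bound:
  assumes "tree_ptime f"
  obtains q where "\<And>x. tree_size (f x) \<le> poly q (tree_size x)"
proof -
  obtain q where q: "\<And>b. \<exists>c. runs c b f q" using assms unfolding tree_ptime_def by blast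
  have "tree_size (f x) \<le> poly q (tree_size x)" for x
  proof -
    obtain c where "runs c 0 f q" using q by blast
    then show ?thesis by (rule runsE[where s = "\<lambda>_. x"]) simp
  qed
  then show ?thesis by (rule that)
qed

lemma tree_ptime_tfold:
  assumes "tree_ptime (\<lambda>x. g (hd_tree x) (hd_tree (tl_tree x)) (tl_tree (tl_tree x)))"
    and "\<And>c h a. tree_size (g c h a) \<le> tree_size a + poly P (tree_size c + tree_size h)"
    and "tree_ptime c" "tree_ptime l" "tree_ptime a"
  shows "tree_ptime (\<lambda>x. tfold g (c x) (l x) (a x))"
  using tree_ptime_comp[OF tree_ptime_tfold_raw[OF assms(1,2)]
      tree_ptime_Node[OF assms(3) tree_ptime_Node[OF assms(4,5)]]]
  by simp

definition trev :: "tree \<Rightarrow> tree" where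
  "trev l = tfold (\<lambda>_. Node) Leaf l Leaf"

lemma tree_ptime_trev: "tree_ptime l \<Longrightarrow> tree_ptime (\<lambda>x. trev (l x))"
  unfolding trev_def by (rule tree_ptime_tfold[where P = "[:1, 1:]"]) (auto intro!: tree_ptime_intros)

fun tfoldr :: "(tree \<Rightarrow> tree \<Rightarrow> tree \<Rightarrow> tree) \<Rightarrow> tree \<Rightarrow> tree \<Rightarrow> tree \<Rightarrow> tree" where
  "tfoldr g c Leaf a = a"
| "tfoldr g c (Node h t) a = g c h (tfoldr g c t a)"

text \<open>Reversing the list first turns a right fold into a left fold. The general
  \<open>r\<close> is the part of the list that is already reversed.\<close>

lemma tfold_tfold_Node: "tfold g c (tfold (\<lambda>_. Node) Leaf l r) a = tfold g c r (tfoldr g c l a)"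
  by (induction l arbitrary: r) auto

lemma tfoldr_conv_tfold: "tfoldr g c l a = tfold g c (trev l) a"
  unfolding trev_def tfold_tfold_Node by simp

lemma tree_ptime_tfoldr:
  assumes "tree_ptime (\<lambda>x. g (hd_tree x) (hd_tree (tl_tree x)) (tl_tree (tl_tree x)))"
    and "\<And>c h a. tree_size (g c h a) \<le> tree_size a + poly P (tree_size c + tree_size h)"
    and "tree_ptime c" "tree_ptime l" "tree_ptime a"
  shows "tree_ptime (\<lambda>x. tfoldr g (c x) (l x) (a x))"
  unfolding tfoldr_conv_tfold
  by (rule tree_ptime_tfold[OF assms(1,2,3) tree_ptime_trev[OF assms(4)] assms(5)])

section \<open>Polynomial-time functions on encoded data\<close>

text \<open>A term with free variables is a function of its environment, which \<open>E\<close>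
  encodes. The rules below follow the syntax of the term, and entering a binder extends the
  environment by \<open>enc_pair\<close>.\<close>

definition computes :: "('a \<Rightarrow> tree) \<Rightarrow> ('b \<Rightarrow> tree) \<Rightarrow> ('a \<Rightarrow> 'b) \<Rightarrow> bool" where
  "computes E e f \<longleftrightarrow> (\<exists>F. tree_ptime F \<and> (\<forall>x. F (E x) = e (f x)))"

fun enc_pair :: "('a \<Rightarrow> tree) \<Rightarrow> ('b \<Rightarrow> tree) \<Rightarrow> 'a \<times> 'b \<Rightarrow> tree" where
  "enc_pair e e' (x, y) = Node (e x) (e' y)"

lemma computes_poly_time_computable:
  assumes "computes enc_in enc_out f"
  shows "poly_time_computable enc_in enc_out S f"
proof -
  obtain F where F: "tree_ptime F" "\<And>x. F (enc_in x) = enc_out (f x)"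
    using assms unfolding computes_def by blast
  then obtain q c where c: "runs c 0 F q" unfolding tree_ptime_def by blast
  show ?thesis unfolding poly_time_computable_def
  proof (rule exI, rule exI, rule ballI)
    fix x
    let ?s = "(\<lambda>_. Leaf)(0 := enc_in x)"
    obtain t s' where "exec c ?s t s'" "s' 0 = F (?s 0)"
      "t + tree_size (F (?s 0)) \<le> poly q (tree_size (?s 0))"
      using c[unfolded runs_def, rule_format, of ?s] by auto
    then have "exec c ?s t s' \<and> s' 0 = enc_out (f x) \<and> t \<le> poly q (tree_size (enc_in x))"
      using F(2) by simp
    then show "\<exists>t s. exec c ?s t s \<and> s 0 = enc_out (f x) \<and> t \<le> poly q (tree_size (enc_in x))"
      by blast
  qed
qed

lemma computesI: "tree_ptime F \<Longrightarrow> (\<And>x. F (E x) = e (f x)) \<Longrightarrow> computes E e f"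
  unfolding computes_def by blast

lemma computes_const: "computes E e (\<lambda>_. y)"
  by (rule computesI[OF tree_ptime_const]) simp

lemma computes_snd: "computes (enc_pair E e) e snd"
  by (rule computesI[OF tree_ptime_tl_tree]) auto

text \<open>Lookup of an outer variable: the newest binding is dropped. \<open>computes_snd\<close>
  yields the newest binding itself.\<close>

lemma computes_fst:
  assumes "computes E e f"
  shows "computes (enc_pair E e') e (\<lambda>x. f (fst x))"
proof -
  obtain F where "tree_ptime F" "\<And>x. F (E x) = e (f x)"
    using assms unfolding computes_def by blast
  then show ?thesis
    by (intro computesI[where F = "\<lambda>x. F (hd_tree x)"] tree_ptime_comp[OF _ tree_ptime_hd_tree]) auto
qed

lemma computes_tree1:
  assumes "computes E e f" "tree_ptime G" "\<And>y. G (e y) = e' (g y)"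
  shows "computes E e' (\<lambda>x. g (f x))"
proof -
  obtain F where "tree_ptime F" "\<And>x. F (E x) = e (f x)"
    using assms unfolding computes_def by blast
  then show ?thesis
    by (intro computesI[where F = "\<lambda>x. G (F x)"] tree_ptime_comp[OF assms(2)]) (auto simp: assms)
qed

lemma computes_tree2:
  assumes "computes E e1 f1" "computes E e2 f2" "tree_ptime G"
    and "\<And>y z. G (Node (e1 y) (e2 z)) = e' (g y z)"
  shows "computes E e' (\<lambda>x. g (f1 x) (f2 x))"
proof -
  obtain F1 where "tree_ptime F1" "\<And>x. F1 (E x) = e1 (f1 x)"
    using assms unfolding computes_def by blast
  moreover obtain F2 where "tree_ptime F2" "\<And>x. F2 (E x) = e2 (f2 x)"
    using assms unfolding computes_def by blast
  ultimately show ?thesis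
    by (intro computesI[where F = "\<lambda>x. G (Node (F1 x) (F2 x))"] tree_ptime_comp[OF assms(3)]
        tree_ptime_Node) (auto simp: assms)
qed

lemma computes_Pair:
  assumes "computes E e f" "computes E e' g"
  shows "computes E (enc_pair e e') (\<lambda>x. (f x, g x))"
  by (rule computes_tree2[OF assms tree_ptime_id]) simp

lemma computes_If:
  assumes "computes E enc_bool P" "computes E e f" "computes E e g"
  shows "computes E e (\<lambda>x. if P x then f x else g x)"
proof -
  obtain Q where "tree_ptime Q" "\<And>x. Q (E x) = enc_bool (P x)"
    using assms unfolding computes_def by blast
  moreover obtain F where "tree_ptime F" "\<And>x. F (E x) = e (f x)"
    using assms unfolding computes_def by blast
  moreover obtain G where "tree_ptime G" "\<And>x. G (E x) = e (g x)"
    using assms unfolding computes_def by blast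
  ultimately show ?thesis
    by (intro computesI[where F = "\<lambda>x. if Q x = Leaf then G x else F x"] tree_ptime_If)
      (auto simp: enc_bool_def)
qed

text \<open>The encoded environment is the parameter of the fold, which lets \<open>g\<close> depend
  on \<open>x\<close> as well as on the list element.\<close>

lemma computes_map:
  assumes xs: "computes E (enc_list e) xs" and g: "computes (enc_pair E e) e' (\<lambda>z. g (fst z) (snd z))"
  shows "computes E (enc_list e') (\<lambda>x. map (g x) (xs x))"
proof -
  obtain X where X: "tree_ptime X" "\<And>x. X (E x) = enc_list e (xs x)"
    using xs unfolding computes_def by blast
  obtain G where G: "tree_ptime G" "\<And>x y. G (Node (E x) (e y)) = e' (g x y)"
    using g unfolding computes_def by force
  let ?step = "\<lambda>c h a. Node (G (Node c h)) a"
  obtain q where q: "\<And>x. tree_size (G x) \<le> poly q (tree_size x)"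
    using tree_ptime_bound[OF G(1)] by blast
  \<comment> \<open>An element adds one node and the size of \<open>G (Node c h)\<close>,
    independently of the accumulator \<open>a\<close>.\<close>
  have pq: "tree_size (?step c h a)
      \<le> tree_size a + poly (1 + pcompose q [:1, 1:]) (tree_size c + tree_size h)" for c h a
    using q[of "Node c h"] by (simp add: poly_pcompose)
  have "tfoldr ?step (E x) (enc_list e ys) Leaf = enc_list e' (map (g x) ys)" for x ys
    by (induction ys) (auto simp: G)
  moreover have "tree_ptime (\<lambda>x. tfoldr ?step x (X x) Leaf)"
    by (rule tree_ptime_tfoldr[OF _ pq tree_ptime_id X(1) tree_ptime_const])
      (intro tree_ptime_intros tree_ptime_comp[OF G(1)])
  ultimately show ?thesis
    by (intro computesI[where F = "\<lambda>x. tfoldr ?step x (X x) Leaf"]) (auto simp: X)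
qed

lemma computes_append:
  assumes "computes E (enc_list e) xs" "computes E (enc_list e) ys"
  shows "computes E (enc_list e) (\<lambda>x. xs x @ ys x)"
proof (rule computes_tree2[OF assms])
  show "tree_ptime (\<lambda>x. tfoldr (\<lambda>_. Node) Leaf (hd_tree x) (tl_tree x))"
    by (rule tree_ptime_tfoldr[where P = "[:1, 1:]"]) (auto intro!: tree_ptime_intros)
  show "tfoldr (\<lambda>_. Node) Leaf (hd_tree (Node (enc_list e y) (enc_list e z)))
     (tl_tree (Node (enc_list e y) (enc_list e z))) = enc_list e (y @ z)" for y z
    by (induction y) auto
qed

lemma computes_Nil: "computes E (enc_list e) (\<lambda>_. [])"
  by (rule computes_const)

lemma computes_Cons:
  assumes "computes E e y" "computes E (enc_list e) ys"
  shows "computes E (enc_list e) (\<lambda>x. y x # ys x)"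
  by (rule computes_tree2[OF assms tree_ptime_id]) simp

lemma computes_concat_replicate:
  assumes "computes E (enc_list e) xs"
  shows "computes E (enc_list e) (\<lambda>x. concat (replicate K (xs x)))"
  by (induction K) (auto intro: computes_Nil computes_append assms)

section \<open>Arithmetic on unary numbers\<close>

lemma enc_unary_0 [simp]: "enc_unary 0 = Leaf"
  by (simp add: enc_unary_def)

lemma enc_unary_Suc [simp]: "enc_unary (Suc n) = Node Leaf (enc_unary n)"
  by (simp add: enc_unary_def)

lemma computes_add:
  assumes "computes E enc_unary a" "computes E enc_unary b"
  shows "computes E enc_unary (\<lambda>x. a x + b x)"
proof (rule computes_tree2[OF assms])
  show "tree_ptime (\<lambda>x. tfoldr (\<lambda>_. Node) Leaf (hd_tree x) (tl_tree x))"
    by (rule tree_ptime_tfoldr[where P = "[:1, 1:]"]) (auto intro!: tree_ptime_intros)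
  show "tfoldr (\<lambda>_. Node) Leaf (hd_tree (Node (enc_unary y) (enc_unary z)))
     (tl_tree (Node (enc_unary y) (enc_unary z))) = enc_unary (y + z)" for y z
    by (induction y) auto
qed

lemma computes_const_mult:
  assumes "computes E enc_unary a"
  shows "computes E enc_unary (\<lambda>x. K * a x)"
  by (induction K) (auto intro: computes_const computes_add assms)

text \<open>Each element of \<open>b\<close> removes one element of \<open>a\<close>. As unary
  numbers are lists, this is truncated subtraction as well as \<open>drop\<close>.\<close>

definition tdiff :: "tree \<Rightarrow> tree \<Rightarrow> tree" where
  "tdiff a b = tfoldr (\<lambda>_ _. tl_tree) Leaf b a"

lemma tree_ptime_tdiff:
  "tree_ptime f \<Longrightarrow> tree_ptime g \<Longrightarrow> tree_ptime (\<lambda>x. tdiff (f x) (g x))"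
  unfolding tdiff_def
  by (rule tree_ptime_tfoldr[where P = 0]) (auto intro!: tree_ptime_intros tree_size_tl_le)

lemma tree_size_tdiff_le: "tree_size (tdiff a b) \<le> tree_size a"
  unfolding tdiff_def by (induction b) (auto intro: order_trans[OF tree_size_tl_le])

lemma tdiff_enc_list: "tdiff (enc_list e ys) (enc_unary n) = enc_list e (drop n ys)"
proof -
  have "tl_tree (enc_list e zs) = enc_list e (tl zs)" for zs
    by (cases zs) auto
  then show ?thesis
    unfolding tdiff_def by (induction n) (auto simp: drop_Suc tl_drop)
qed

lemma tdiff_enc_unary: "tdiff (enc_unary m) (enc_unary n) = enc_unary (m - n)"
  using tdiff_enc_list[of "\<lambda>_. Leaf" "replicate m ()" n]
  by (simp add: enc_unary_def)

definition tlength :: "tree \<Rightarrow> tree" where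
  "tlength a = tfoldr (\<lambda>_ _. Node Leaf) Leaf a Leaf"

lemma tree_ptime_tlength: "tree_ptime f \<Longrightarrow> tree_ptime (\<lambda>x. tlength (f x))"
  unfolding tlength_def
  by (rule tree_ptime_tfoldr[where P = 2]) (auto intro!: tree_ptime_intros simp: numeral_poly)

lemma tlength_enc_list: "tlength (enc_list e xs) = enc_unary (length xs)"
  unfolding tlength_def by (induction xs) auto

lemma computes_diff:
  assumes "computes E enc_unary a" "computes E enc_unary b"
  shows "computes E enc_unary (\<lambda>x. a x - b x)"
  by (rule computes_tree2[OF assms, where G = "\<lambda>x. tdiff (hd_tree x) (tl_tree x)"])
    (auto intro!: tree_ptime_tdiff tree_ptime_intros simp: tdiff_enc_unary)

lemma computes_eq:
  assumes "computes E enc_unary a" "computes E enc_unary b"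
  shows "computes E enc_bool (\<lambda>x. a x = b x)"
proof -
  \<comment> \<open>Both truncated differences vanish exactly for equal numbers, and zero is encoded
    as \<open>Leaf\<close>.\<close>
  have "computes E enc_bool (\<lambda>x. (a x - b x) + (b x - a x) = 0)"
  proof (rule computes_tree1[OF computes_add[OF computes_diff[OF assms] computes_diff[OF assms(2,1)]]])
    show "tree_ptime (\<lambda>x. if x = Leaf then Node Leaf Leaf else Leaf)"
      by (intro tree_ptime_intros)
    show "(if enc_unary y = Leaf then Node Leaf Leaf else Leaf) = enc_bool (y = 0)" for y
      by (cases y) (auto simp: enc_bool_def)
  qed
  moreover have "(a x - b x) + (b x - a x) = 0 \<longleftrightarrow> a x = b x" for x by auto
  ultimately show ?thesis by simp
qed

lemma computes_length:
  assumes "computes E (enc_list e) xs"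
  shows "computes E enc_unary (\<lambda>x. length (xs x))"
  by (rule computes_tree1[OF assms tree_ptime_tlength[OF tree_ptime_id]]) (rule tlength_enc_list)

lemma computes_rev:
  assumes "computes E (enc_list e) xs"
  shows "computes E (enc_list e) (\<lambda>x. rev (xs x))"
proof (rule computes_tree1[OF assms])
  show "tree_ptime trev" using tree_ptime_trev[OF tree_ptime_id] .
  have "tfold (\<lambda>_. Node) Leaf (enc_list e ys) (enc_list e zs) = enc_list e (rev ys @ zs)" for ys zs
  proof (induction ys arbitrary: zs)
    case (Cons y ys)
    from Cons[of "y # zs"] show ?case by simp
  qed simp
  from this[of _ "[]"] show "trev (enc_list e ys) = enc_list e (rev ys)" for ys
    by (simp add: trev_def)
qed

text \<open>The fold conses the current length onto the list. The double subtraction leaves it unchanged;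
  it only makes the step obviously bounded in terms of \<open>n\<close>, as the fold rule demands.\<close>

lemma computes_upt:
  assumes "computes E enc_unary n"
  shows "computes E (enc_list enc_unary) (\<lambda>x. [0..<n x])"
proof -
  let ?step = "\<lambda>c _ a. Node (tdiff c (tdiff c (tlength a))) a"
  have fold: "tfoldr ?step (enc_unary n) (enc_unary j) Leaf = enc_list enc_unary (rev [0..<j])"
    if "j \<le> n" for n j
    using that by (induction j) (auto simp: tlength_enc_list tdiff_enc_unary)
  have "tree_ptime (\<lambda>x. tfoldr ?step x x Leaf)"
  proof (rule tree_ptime_tfoldr[where P = "[:1, 1:]"])
    show "tree_size (?step c h a) \<le> tree_size a + poly [:1, 1:] (tree_size c + tree_size h)" for c h a
      using tree_size_tdiff_le[of c] by (simp add: trans_le_add1)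
  qed (intro tree_ptime_intros tree_ptime_tdiff tree_ptime_tlength)+
  then have "computes E (enc_list enc_unary) (\<lambda>x. rev [0..<n x])"
    by (rule computes_tree1[OF assms]) (rule fold[OF order_refl])
  from computes_rev[OF this] show ?thesis by simp
qed

section \<open>Real expressions and the components of an instance\<close>

fun sum_rexpr :: "rexpr list \<Rightarrow> rexpr" where
  "sum_rexpr [] = Const 0"
| "sum_rexpr (a # as) = Add a (sum_rexpr as)"

lemma val_sum_rexpr: "val p (sum_rexpr as) = (\<Sum>a\<leftarrow>as. val p a)"
  by (induction as) auto

lemma computes_sum_rexpr:
  assumes "computes E (enc_list enc_rexpr) as"
  shows "computes E enc_rexpr (\<lambda>x. sum_rexpr (as x))"
proof (rule computes_tree1[OF assms])
  let ?step = "\<lambda>_ h a. Node (enc_unary 1) (Node h a)"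
  show "tree_ptime (\<lambda>x. tfoldr ?step Leaf x (enc_rexpr (Const 0)))"
    by (rule tree_ptime_tfoldr[where P = "[:5, 1:]"]) (auto intro!: tree_ptime_intros)
  show "tfoldr ?step Leaf (enc_list enc_rexpr y) (enc_rexpr (Const 0)) = enc_rexpr (sum_rexpr y)" for y
    by (induction y) auto
qed

lemma computes_Add:
  assumes "computes E enc_rexpr a" "computes E enc_rexpr b"
  shows "computes E enc_rexpr (\<lambda>x. Add (a x) (b x))"
  by (rule computes_tree2[OF assms, where G = "Node (enc_unary 1)"])
    (auto intro!: tree_ptime_intros)

lemma computes_Mul:
  assumes "computes E enc_rexpr a" "computes E enc_rexpr b"
  shows "computes E enc_rexpr (\<lambda>x. Mul (a x) (b x))"
  by (rule computes_tree2[OF assms, where G = "Node (enc_unary 3)"])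
    (auto intro!: tree_ptime_intros)

lemma computes_PPow:
  assumes "computes E enc_rexpr a"
  shows "computes E enc_rexpr (\<lambda>x. PPow (a x))"
  by (rule computes_tree1[OF assms, where G = "Node (enc_unary 5)"])
    (auto intro!: tree_ptime_intros)

lemma computes_PRoot:
  assumes "computes E enc_rexpr a"
  shows "computes E enc_rexpr (\<lambda>x. PRoot (a x))"
  by (rule computes_tree1[OF assms, where G = "Node (enc_unary 6)"])
    (auto intro!: tree_ptime_intros)

text \<open>The two leaves are the tag \<open>enc_unary 0\<close> of a constant and the sign bit of
  a nonnegative number.\<close>

lemma computes_Const_of_nat:
  assumes "computes E enc_binary a"
  shows "computes E enc_rexpr (\<lambda>x. Const (int (a x)))"
  by (rule computes_tree1[OF assms, where G = "\<lambda>x. Node Leaf (Node Leaf x)"])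
    (auto intro!: tree_ptime_intros simp: enc_int_def enc_bool_def)

text \<open>\<open>computes\<close> demands an equation for every input, so list access is made
  total by a default. An index beyond the end shows up as an empty list after dropping.\<close>

lemma computes_nth_default:
  assumes "computes E (enc_list e) xs" "computes E enc_unary i"
  shows "computes E e (\<lambda>x. nth_default d (xs x) (i x))"
proof (rule computes_tree2[OF assms])
  let ?drop = "\<lambda>x. tdiff (hd_tree x) (tl_tree x)"
  let ?G = "\<lambda>x. if ?drop x = Leaf then e d else hd_tree (?drop x)"
  show "tree_ptime ?G"
    by (intro tree_ptime_intros tree_ptime_tdiff)
  show "?G (Node (enc_list e ys) (enc_unary n)) = e (nth_default d ys n)" for ys n
  proof (cases "n < length ys")
    case True
    then have "drop n ys = ys ! n # drop (Suc n) ys" by (simp add: Cons_nth_drop_Suc)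
    with True show ?thesis by (simp add: nth_default_def tdiff_enc_list)
  qed (simp add: nth_default_def tdiff_enc_list)
qed

lemma computes_literal_fst: "computes E enc_literal l \<Longrightarrow> computes E enc_bool (\<lambda>x. fst (l x))"
  by (erule computes_tree1[OF _ tree_ptime_hd_tree]) (simp add: enc_literal_def)

lemma computes_literal_snd: "computes E enc_literal l \<Longrightarrow> computes E enc_unary (\<lambda>x. snd (l x))"
  by (erule computes_tree1[OF _ tree_ptime_tl_tree]) (simp add: enc_literal_def)

lemma computes_clause_fst:
  "computes E enc_weighted_clause c \<Longrightarrow> computes E (enc_list enc_literal) (\<lambda>x. fst (c x))"
  by (erule computes_tree1[OF _ tree_ptime_hd_tree]) (simp add: enc_weighted_clause_def)

lemma computes_clause_snd:
  "computes E enc_weighted_clause c \<Longrightarrow> computes E enc_binary (\<lambda>x. snd (c x))"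
  by (erule computes_tree1[OF _ tree_ptime_tl_tree]) (simp add: enc_weighted_clause_def)

lemma computes_num_vars: "computes enc_wcnf enc_unary num_vars"
  by (rule computesI[OF tree_ptime_hd_tree]) (simp add: enc_wcnf_def)

lemma computes_clauses: "computes enc_wcnf (enc_list enc_weighted_clause) clauses"
  by (rule computesI[where F = "\<lambda>x. hd_tree (tl_tree x)"])
    (auto intro!: tree_ptime_intros simp: enc_wcnf_def)

lemma computes_threshold: "computes enc_wcnf enc_binary threshold"
  by (rule computesI[where F = "\<lambda>x. tl_tree (tl_tree x)"])
    (auto intro!: tree_ptime_intros simp: enc_wcnf_def)

section \<open>The reduction\<close>

definition clause_at :: "wcnf \<Rightarrow> nat \<Rightarrow> clause \<times> nat" where
  "clause_at I c = nth_default ([], 0) (clauses I) c"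

definition total_weight_expr :: "wcnf \<Rightarrow> rexpr" where
  "total_weight_expr I = sum_rexpr (map (\<lambda>C. Const (int (snd C))) (clauses I))"

definition scale_expr :: "wcnf \<Rightarrow> rexpr" where
  "scale_expr I = Add (Const 1) (total_weight_expr I)"

text \<open>Twice a positive literal is \<open>2 z\<close> and twice a negative one is
  \<open>2 - 2 z\<close>; only the linear parts enter the basis. Summing over all literals covers
  repeated and complementary ones.\<close>

definition var_coeff_expr :: "clause \<times> nat \<Rightarrow> nat \<Rightarrow> rexpr" where
  "var_coeff_expr C i = Mul (PRoot (Const (int (snd C)))) (sum_rexpr (map (\<lambda>l.
     if snd l = i then (if fst l then Const 2 else Const (-2)) else Const 0) (fst C)))"

text \<open>The constants \<open>2\<close> of the negative literals move to the target, where they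
  reduce the \<open>3\<close> of \<open>2 (s - y) - 3\<close>.\<close>

definition clause_target_expr :: "clause \<times> nat \<Rightarrow> rexpr" where
  "clause_target_expr C = Mul (PRoot (Const (int (snd C)))) (Add (Const 3) (sum_rexpr (map (\<lambda>l.
     if fst l then Const 0 else Const (-2)) (fst C))))"

text \<open>The auxiliary columns come in \<open>k - 2\<close> blocks, each with one column per clause, so the
  \<open>j\<close>-th auxiliary variable of clause \<open>c\<close> has index \<open>n + j m + c\<close>.\<close>

definition clause_row :: "nat \<Rightarrow> wcnf \<Rightarrow> nat \<Rightarrow> rexpr list" where
  "clause_row k I c = map (var_coeff_expr (clause_at I c)) [0..<num_vars I] @
     concat (replicate (k - 2) (map (\<lambda>c'. if c' = c
       then Mul (PRoot (Const (int (snd (clause_at I c))))) (Const (-2)) else Const 0)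
       [0..<num_clauses I]))"

definition reduction_rank :: "nat \<Rightarrow> wcnf \<Rightarrow> nat" where
  "reduction_rank k I = num_vars I + (k - 2) * num_clauses I"

text \<open>The last row of the basis is zero: its target entry adds the constant \<open>1 + 3\<^sup>p W\<close> to the \<open>p\<close>-th power of every
  distance. This moves \<open>W\<close> to the other side of the comparison, so that the radius needs no
  subtraction and stays positive also for a threshold above the total weight.\<close>

definition reduction :: "nat \<Rightarrow> wcnf \<Rightarrow> cvp_desc" where
  "reduction k I = (let N = reduction_rank k I in
     \<lparr>desc_rank = N,
      desc_rows =
        map (\<lambda>i. map (\<lambda>j. if j = i then Mul (PRoot (scale_expr I)) (Const 2) else Const 0) [0..<N]) [0..<N] @
        map (clause_row k I) [0..<num_clauses I] @
        [map (\<lambda>j. Const 0) [0..<N]],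
      desc_target =
        map (\<lambda>i. PRoot (scale_expr I)) [0..<N] @
        map (\<lambda>c. clause_target_expr (clause_at I c)) [0..<num_clauses I] @
        [PRoot (Add (Const 1) (Mul (PPow (Const 3)) (Const (int (threshold I)))))],
      desc_radius = PRoot (Add (Add (Const 1) (Const (int (threshold I))))
        (Add (sum_rexpr (map (\<lambda>i. scale_expr I) [0..<N]))
             (Mul (PPow (Const 3)) (total_weight_expr I))))\<rparr>)"

section \<open>Computability of the reduction\<close>

lemma computes_num_clauses: "computes enc_wcnf enc_unary num_clauses"
  unfolding num_clauses_def by (rule computes_length[OF computes_clauses])

lemma computes_total_weight_expr: "computes enc_wcnf enc_rexpr total_weight_expr"
  unfolding total_weight_expr_def
  by (rule computes_sum_rexpr computes_map computes_clauses computes_Const_of_nat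
      computes_clause_snd computes_snd)+

lemma computes_scale_expr: "computes enc_wcnf enc_rexpr scale_expr"
  unfolding scale_expr_def by (intro computes_Add computes_const computes_total_weight_expr)

lemma computes_reduction_rank: "computes enc_wcnf enc_unary (reduction_rank k)"
  unfolding reduction_rank_def
  by (intro computes_add computes_const_mult computes_num_vars computes_num_clauses)

lemma computes_clause_at:
  "computes (enc_pair enc_wcnf enc_unary) enc_weighted_clause (\<lambda>z. clause_at (fst z) (snd z))"
  unfolding clause_at_def
  by (rule computes_nth_default computes_fst computes_clauses computes_snd)+

lemma computes_var_coeff_expr:
  assumes "computes E enc_weighted_clause C" "computes E enc_unary i"
  shows "computes E enc_rexpr (\<lambda>x. var_coeff_expr (C x) (i x))"
  unfolding var_coeff_expr_def
  by (rule computes_Mul computes_PRoot computes_Const_of_nat computes_clause_snd assms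
      computes_sum_rexpr computes_map computes_clause_fst computes_If computes_eq
      computes_literal_snd computes_literal_fst computes_snd computes_const
      computes_fst[where f = i])+

lemma computes_clause_target_expr:
  assumes "computes E enc_weighted_clause C"
  shows "computes E enc_rexpr (\<lambda>x. clause_target_expr (C x))"
  unfolding clause_target_expr_def
  by (rule computes_Mul computes_PRoot computes_Const_of_nat computes_clause_snd assms
      computes_Add computes_sum_rexpr computes_map computes_clause_fst computes_If
      computes_literal_fst computes_snd computes_const)+

lemma computes_clause_row:
  "computes (enc_pair enc_wcnf enc_unary) (enc_list enc_rexpr) (\<lambda>z. clause_row k (fst z) (snd z))"
  unfolding clause_row_def
proof (rule computes_append)
  show "computes (enc_pair enc_wcnf enc_unary) (enc_list enc_rexpr)
     (\<lambda>z. map (var_coeff_expr (clause_at (fst z) (snd z))) [0..<num_vars (fst z)])"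
    by (rule computes_map computes_upt computes_fst[OF computes_num_vars] computes_var_coeff_expr
        computes_fst[OF computes_clause_at] computes_snd)+
  show "computes (enc_pair enc_wcnf enc_unary) (enc_list enc_rexpr)
     (\<lambda>z. concat (replicate (k - 2) (map (\<lambda>c'. if c' = snd z
       then Mul (PRoot (Const (int (snd (clause_at (fst z) (snd z)))))) (Const (-2)) else Const 0)
       [0..<num_clauses (fst z)])))"
    by (rule computes_concat_replicate computes_map computes_upt
        computes_fst[OF computes_num_clauses] computes_If computes_eq computes_Mul computes_PRoot
        computes_Const_of_nat computes_clause_snd computes_fst[OF computes_clause_at]
        computes_fst[OF computes_snd] computes_snd computes_const)+
qed

lemma computes_cvp_desc:
  assumes "computes E enc_unary N" "computes E (enc_list (enc_list enc_rexpr)) bs"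
    "computes E (enc_list enc_rexpr) t" "computes E enc_rexpr r"
  shows "computes E enc_cvp_desc
    (\<lambda>x. \<lparr>desc_rank = N x, desc_rows = bs x, desc_target = t x, desc_radius = r x\<rparr>)"
proof -
  \<comment> \<open>The record is encoded like a nested tuple of its fields, so the identity on
    trees converts one into the other.\<close>
  have "computes E enc_cvp_desc (\<lambda>x. (\<lambda>(N, bs, t, r).
      \<lparr>desc_rank = N, desc_rows = bs, desc_target = t, desc_radius = r\<rparr>) (N x, bs x, t x, r x))"
    by (rule computes_tree1[OF _ tree_ptime_id], (rule computes_Pair assms)+)
      (auto simp: enc_cvp_desc_def)
  then show ?thesis by simp
qed

lemma computes_reduction: "computes enc_wcnf enc_cvp_desc (reduction k)"
  unfolding reduction_def Let_def
proof (rule computes_cvp_desc)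
  \<comment> \<open>The depth of \<open>computes_fst\<close> counts the bound variables to be
    skipped: \<open>scale_expr I\<close> lies under \<open>i\<close> and \<open>j\<close> in the
    rows, but only under \<open>i\<close> in the target and the radius.\<close>
  note simple = computes_append computes_map computes_upt computes_reduction_rank computes_If computes_eq
    computes_Cons computes_Nil computes_Add computes_Mul computes_PRoot computes_PPow
    computes_sum_rexpr computes_num_clauses computes_fst[OF computes_reduction_rank]
    computes_fst[OF computes_scale_expr] computes_fst[OF computes_fst[OF computes_scale_expr]]
    computes_scale_expr computes_total_weight_expr computes_clause_row computes_clause_target_expr computes_clause_at
    computes_snd computes_fst[OF computes_snd] computes_Const_of_nat computes_threshold
  show "computes enc_wcnf enc_unary (reduction_rank k)" by (rule simple)
  show "computes enc_wcnf (enc_list (enc_list enc_rexpr)) (\<lambda>I.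
        map (\<lambda>i. map (\<lambda>j. if j = i then Mul (PRoot (scale_expr I)) (Const 2) else Const 0)
          [0..<reduction_rank k I]) [0..<reduction_rank k I] @
        map (clause_row k I) [0..<num_clauses I] @
        [map (\<lambda>j. Const 0) [0..<reduction_rank k I]])"
    by (rule simple computes_const)+
  show "computes enc_wcnf (enc_list enc_rexpr) (\<lambda>I.
        map (\<lambda>i. PRoot (scale_expr I)) [0..<reduction_rank k I] @
        map (\<lambda>c. clause_target_expr (clause_at I c)) [0..<num_clauses I] @
        [PRoot (Add (Const 1) (Mul (PPow (Const 3)) (Const (int (threshold I)))))])"
    by (rule simple computes_const)+
  show "computes enc_wcnf enc_rexpr (\<lambda>I. PRoot (Add (Add (Const 1) (Const (int (threshold I))))
        (Add (sum_rexpr (map (\<lambda>i. scale_expr I) [0..<reduction_rank k I]))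
             (Mul (PPow (Const 3)) (total_weight_expr I)))))"
    by (rule simple computes_const)+
qed

section \<open>Distances and satisfied weights\<close>

text \<open>Affine in \<open>z\<close>, hence expressible by lattice coordinates; for binary
  \<open>z\<close> it is the truth value.\<close>

definition lit_val :: "(nat \<Rightarrow> int) \<Rightarrow> literal \<Rightarrow> int" where
  "lit_val z l = (if fst l then z (snd l) else 1 - z (snd l))"

text \<open>For a binary \<open>z\<close> the sum of the auxiliary variables ranges over \<open>0, \<dots>, k - 2\<close>. The slack is odd,
  and it can be made \<open>\<plusminus>1\<close> if at least one literal is true and is at most \<open>-3\<close> otherwise.\<close>

definition slack :: "nat \<Rightarrow> wcnf \<Rightarrow> (nat \<Rightarrow> int) \<Rightarrow> nat \<Rightarrow> int" where
  "slack k I z c = 2 * ((\<Sum>l\<leftarrow>fst (clauses I ! c). lit_val z l) -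
     (\<Sum>j<k - 2. z (num_vars I + j * num_clauses I + c))) - 3"

definition total_weight :: "wcnf \<Rightarrow> nat" where
  "total_weight I = (\<Sum>c<num_clauses I. snd (clauses I ! c))"

text \<open>The \<open>p\<close>-th power of a distance: the three summands come from the diagonal
  rows, the clause rows and the zero row.\<close>

definition cost :: "real \<Rightarrow> nat \<Rightarrow> wcnf \<Rightarrow> (nat \<Rightarrow> int) \<Rightarrow> real" where
  "cost p k I z =
     (\<Sum>i<reduction_rank k I. (1 + total_weight I) * \<bar>2 * real_of_int (z i) - 1\<bar> powr p) +
     (\<Sum>c<num_clauses I. snd (clauses I ! c) * \<bar>real_of_int (slack k I z c)\<bar> powr p) +
     (1 + 3 powr p * threshold I)"

text \<open>Let \<open>N\<close> be the rank, \<open>V\<close> the total weight and \<open>W\<close>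
  the threshold. A binary vector with optimal auxiliary variables whose assignment satisfies weight
  \<open>s\<close> costs \<open>N * (1 + V) + s + 3 powr p * (V - s) + 1 + 3 powr p * W\<close>. The
  budget is this value at \<open>s = W\<close>, and for \<open>p \<ge> 1\<close> the value decreases
  in \<open>s\<close>.\<close>

definition budget :: "real \<Rightarrow> nat \<Rightarrow> wcnf \<Rightarrow> real" where
  "budget p k I = 1 + threshold I + reduction_rank k I * (1 + total_weight I) +
     3 powr p * total_weight I"

lemma one_le_abs_odd_powr:
  assumes "odd u" "p \<ge> 1"
  shows "1 \<le> \<bar>real_of_int u\<bar> powr p"
proof -
  have "1 \<le> \<bar>u\<bar>" using assms(1) by presburger
  then have "1 \<le> \<bar>real_of_int u\<bar>" by linarith
  then show ?thesis using assms(2) by (simp add: ge_one_powr_ge_zero)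
qed

lemma three_powr_le:
  assumes "3 \<le> \<bar>u\<bar>" "p \<ge> 1"
  shows "3 powr p \<le> \<bar>real_of_int u\<bar> powr p"
proof -
  have "3 \<le> \<bar>real_of_int u\<bar>" using assms(1) by linarith
  then show ?thesis using assms(2) by (intro powr_mono2) auto
qed

lemma three_powr_gt_one: "p \<ge> 1 \<Longrightarrow> 1 < 3 powr (p :: real)"
  by (rule gr_one_powr) auto

lemma odd_slack: "odd (slack k I z c)"
  unfolding slack_def by simp

lemma weighted_max_ksatD:
  assumes "I \<in> weighted_max_ksat k" "c < num_clauses I"
  shows "length (fst (clauses I ! c)) = k"
    and "l \<in> set (fst (clauses I ! c)) \<Longrightarrow> snd l < num_vars I"
proof -
  have "clauses I ! c \<in> set (clauses I)" using assms(2) by (simp add: num_clauses_def)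
  then have "length (fst (clauses I ! c)) = k \<and> (\<forall>l\<in>set (fst (clauses I ! c)). snd l < num_vars I)"
    using assms(1) unfolding weighted_max_ksat_def by fastforce
  then show "length (fst (clauses I ! c)) = k"
    and "l \<in> set (fst (clauses I ! c)) \<Longrightarrow> snd l < num_vars I" by auto
qed

lemma aux_index_less:
  assumes "j < k - 2" "c < num_clauses I"
  shows "num_vars I + j * num_clauses I + c < reduction_rank k I"
proof -
  have "j * num_clauses I + c < Suc j * num_clauses I" using assms(2) by simp
  also have "\<dots> \<le> (k - 2) * num_clauses I" using assms(1) by (intro mult_le_mono1) simp
  finally show ?thesis unfolding reduction_rank_def by simp
qed

text \<open>Allows passing from functions to coordinate vectors: literals and auxiliary variables
  only refer to indices below the rank.\<close>

lemma cost_cong: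
  assumes I: "I \<in> weighted_max_ksat k" and eq: "\<And>i. i < reduction_rank k I \<Longrightarrow> z i = z' i"
  shows "cost p k I z = cost p k I z'"
proof -
  have "slack k I z c = slack k I z' c" if c: "c < num_clauses I" for c
  proof -
    have "map (lit_val z) (fst (clauses I ! c)) = map (lit_val z') (fst (clauses I ! c))"
    proof (rule map_cong[OF refl])
      fix l assume "l \<in> set (fst (clauses I ! c))"
      from weighted_max_ksatD(2)[OF I c this] have "z (snd l) = z' (snd l)"
        by (intro eq) (simp add: reduction_rank_def)
      then show "lit_val z l = lit_val z' l" by (simp add: lit_val_def)
    qed
    moreover have "(\<Sum>j<k - 2. z (num_vars I + j * num_clauses I + c)) =
        (\<Sum>j<k - 2. z' (num_vars I + j * num_clauses I + c))"
      using aux_index_less[OF _ c] eq by (intro sum.cong) auto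
    ultimately show ?thesis unfolding slack_def by metis
  qed
  then show ?thesis unfolding cost_def using eq by simp
qed

lemma satisfied_weight_conv_sum:
  "satisfied_weight a I = (\<Sum>c<num_clauses I. if satisfies a (fst (clauses I ! c)) then snd (clauses I ! c) else 0)"
  unfolding satisfied_weight_def num_clauses_def
  by (simp add: sum_list_sum_nth atLeast0LessThan case_prod_beta)

text \<open>Each clause costs \<open>P\<close> times its weight, minus a rebate of
  \<open>P - 1\<close> times its weight if it is satisfied; used with
  \<open>P = 3 powr p\<close>.\<close>

lemma satisfied_weight_real:
  fixes P :: real
  shows "(\<Sum>c<num_clauses I. snd (clauses I ! c) * (if satisfies a (fst (clauses I ! c)) then 1 else P)) =
    satisfied_weight a I + P * (real (total_weight I) - satisfied_weight a I)"
proof -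
  have "(\<Sum>c<num_clauses I. snd (clauses I ! c) * (if satisfies a (fst (clauses I ! c)) then 1 else P)) =
    (\<Sum>c<num_clauses I. P * real (snd (clauses I ! c)) +
       (1 - P) * real (if satisfies a (fst (clauses I ! c)) then snd (clauses I ! c) else 0))"
    by (rule sum.cong) (auto simp: algebra_simps)
  also have "\<dots> = P * total_weight I + (1 - P) * satisfied_weight a I"
    unfolding satisfied_weight_conv_sum total_weight_def sum.distrib of_nat_sum sum_distrib_left ..
  finally show ?thesis by (simp add: algebra_simps)
qed

section \<open>Cheap vectors and good assignments\<close>

text \<open>With total weight \<open>V\<close> and threshold \<open>W\<close>, the least conceivable
  cost leaves \<open>(3 powr p - 1) * (V - W)\<close> of the budget, as an odd slack makes every
  clause cost at least its weight. A coordinate other than 0 and 1 adds at least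
  \<open>(3 powr p - 1) * (1 + V)\<close>, which is more.\<close>

lemma binary_if_cost_le_budget:
  assumes "p \<ge> 1" "cost p k I z \<le> budget p k I" "i < reduction_rank k I"
  shows "z i \<in> {0, 1}"
proof (rule ccontr)
  assume "z i \<notin> {0, 1}"
  let ?N = "reduction_rank k I"
  let ?A = "1 + real (total_weight I)"
  have odd: "odd (2 * z j - 1)" for j by simp
  have one: "1 \<le> \<bar>2 * real_of_int (z j) - 1\<bar> powr p" for j
    using one_le_abs_odd_powr[OF odd assms(1), of j] by simp
  have "3 \<le> \<bar>2 * z i - 1\<bar>" using \<open>z i \<notin> {0, 1}\<close> by auto
  from three_powr_le[OF this assms(1)]
  have three: "3 powr p \<le> \<bar>2 * real_of_int (z i) - 1\<bar> powr p" by simp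
  have "?A * 3 powr p + (real ?N - 1) * ?A = ?A * 3 powr p + (\<Sum>j\<in>{..<?N} - {i}. ?A * 1)"
    using assms(3) by (simp add: of_nat_diff)
  also have "\<dots> \<le> ?A * \<bar>2 * real_of_int (z i) - 1\<bar> powr p +
      (\<Sum>j\<in>{..<?N} - {i}. ?A * \<bar>2 * real_of_int (z j) - 1\<bar> powr p)"
    by (intro add_mono sum_mono mult_left_mono one three) auto
  also have "\<dots> = (\<Sum>j<?N. ?A * \<bar>2 * real_of_int (z j) - 1\<bar> powr p)"
    using assms(3) by (subst (2) sum.remove[of _ i]) auto
  finally have 1: "?A * 3 powr p + (real ?N - 1) * ?A \<le> (\<Sum>j<?N. ?A * \<bar>2 * real_of_int (z j) - 1\<bar> powr p)" .
  have "real (total_weight I) = (\<Sum>c<num_clauses I. real (snd (clauses I ! c)) * 1)"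
    by (simp add: total_weight_def)
  also have "\<dots> \<le> (\<Sum>c<num_clauses I. snd (clauses I ! c) * \<bar>real_of_int (slack k I z c)\<bar> powr p)"
    by (intro sum_mono mult_left_mono one_le_abs_odd_powr odd_slack assms) auto
  finally have 2: "real (total_weight I) \<le> \<dots>" .
  have "?A * 3 powr p + (real ?N - 1) * ?A + total_weight I + (1 + 3 powr p * threshold I) \<le> budget p k I"
    using assms(2) 1 2 unfolding cost_def by simp
  \<comment> \<open>The rank and the total weight cancel; the \<open>1\<close> in the scale
    remains.\<close>
  then have "(3 powr p - 1) * (1 + real (threshold I)) \<le> 0"
    unfolding budget_def by (simp add: algebra_simps)
  moreover have "(3 powr p - 1) * (1 + real (threshold I)) > 0"
    using three_powr_gt_one[OF assms(1)] by (intro mult_pos_pos) auto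
  ultimately show False by linarith
qed

text \<open>The diagonal part costs at least the rank times the scale, so the budget limits the
  clause part. There a clause costs at least its weight, and at least \<open>3 powr p\<close> times
  its weight if unsatisfied, because nonnegative auxiliary variables can only lower the slack below
  \<open>-3\<close>.\<close>

lemma satisfied_weight_if_cost_le_budget:
  assumes p: "p \<ge> 1" and le: "cost p k I z \<le> budget p k I"
    and I: "I \<in> weighted_max_ksat k"
  shows "threshold I \<le> satisfied_weight (\<lambda>i. z i = 1) I"
proof -
  let ?N = "reduction_rank k I"
  let ?a = "\<lambda>i. z i = 1"
  let ?A = "1 + real (total_weight I)"
  have bin: "z i \<in> {0, 1}" if "i < ?N" for i
    using binary_if_cost_le_budget[OF p le that] .
  have odd: "odd (2 * z j - 1)" for j by simp
  have one: "1 \<le> \<bar>2 * real_of_int (z j) - 1\<bar> powr p" for j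
    using one_le_abs_odd_powr[OF odd p, of j] by simp
  have "real ?N * ?A = (\<Sum>j<?N. ?A * 1)" by simp
  also have "\<dots> \<le> (\<Sum>j<?N. ?A * \<bar>2 * real_of_int (z j) - 1\<bar> powr p)"
    by (intro sum_mono mult_left_mono one) auto
  finally have 1: "real ?N * ?A \<le> \<dots>" .
  have slack: "(if satisfies ?a (fst (clauses I ! c)) then 1 else 3 powr p) \<le> \<bar>real_of_int (slack k I z c)\<bar> powr p"
    if c: "c < num_clauses I" for c
  proof (cases "satisfies ?a (fst (clauses I ! c))")
    case True
    then show ?thesis using one_le_abs_odd_powr[OF odd_slack p] by simp
  next
    case False
    note vars = weighted_max_ksatD(2)[OF I c]
    have "lit_val z l = 0" if l: "l \<in> set (fst (clauses I ! c))" for l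
    proof -
      have "snd l < ?N" using vars[OF l] by (simp add: reduction_rank_def)
      then have "z (snd l) \<in> {0, 1}" by (rule bin)
      moreover have "(z (snd l) = 1) \<noteq> fst l"
        using False l by (simp add: satisfies_def case_prod_beta)
      ultimately show ?thesis by (cases "fst l") (auto simp: lit_val_def)
    qed
    then have s: "(\<Sum>l\<leftarrow>fst (clauses I ! c). lit_val z l) = 0"
      by (simp cong: map_cong)
    have "0 \<le> z (num_vars I + j * num_clauses I + c)" if "j < k - 2" for j
      using bin[OF aux_index_less[OF that c]] by auto
    then have "0 \<le> (\<Sum>j<k - 2. z (num_vars I + j * num_clauses I + c))"
      by (intro sum_nonneg) auto
    moreover have "3 \<le> \<bar>2 * (0 - y) - 3\<bar>" if "0 \<le> y" for y :: int
      using that by (simp add: abs_if)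
    ultimately have "3 \<le> \<bar>slack k I z c\<bar>" unfolding slack_def s by blast
    from three_powr_le[OF this p] show ?thesis using False by simp
  qed
  have "satisfied_weight ?a I + 3 powr p * (real (total_weight I) - satisfied_weight ?a I) \<le>
      (\<Sum>c<num_clauses I. snd (clauses I ! c) * \<bar>real_of_int (slack k I z c)\<bar> powr p)"
    unfolding satisfied_weight_real[symmetric]
    by (intro sum_mono mult_left_mono slack) auto
  with 1 le have "(3 powr p - 1) * threshold I \<le> (3 powr p - 1) * satisfied_weight ?a I"
    unfolding cost_def budget_def by (simp add: algebra_simps)
  then show ?thesis using three_powr_gt_one[OF p] by simp
qed

lemma cost_le_budget_if_satisfied_weight:
  assumes p: "p \<ge> 1" and I: "I \<in> weighted_max_ksat k" and k: "k \<ge> 2"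
    and a: "threshold I \<le> satisfied_weight a I"
  shows "\<exists>z. cost p k I z \<le> budget p k I"
proof -
  let ?n = "num_vars I" and ?m = "num_clauses I"
  let ?N = "reduction_rank k I"
  define s where "s c = length (filter (\<lambda>l. a (snd l) = fst l) (fst (clauses I ! c)))" for c
  \<comment> \<open>For a clause with \<open>s\<close> true literals, the first \<open>s - 2\<close>
    auxiliary variables are set to one. Division recovers the block from the column index, and the
    remainder recovers the clause.\<close>
  define z :: "nat \<Rightarrow> int" where "z i = (if i < ?n then of_bool (a i)
     else of_bool ((i - ?n) div ?m < s ((i - ?n) mod ?m) - 2))" for i
  have "\<bar>2 * real_of_int (z i) - 1\<bar> = 1" for i
    unfolding z_def by auto
  then have 1: "(\<Sum>i<?N. (1 + total_weight I) * \<bar>2 * real_of_int (z i) - 1\<bar> powr p) =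
      real ?N * (1 + total_weight I)" by simp
  have slack: "\<bar>real_of_int (slack k I z c)\<bar> powr p = (if satisfies a (fst (clauses I ! c)) then 1 else 3 powr p)"
    if c: "c < ?m" for c
  proof -
    note len = weighted_max_ksatD(1)[OF I c] and vars = weighted_max_ksatD(2)[OF I c]
    have "lit_val z l = of_bool (a (snd l) = fst l)" if "l \<in> set (fst (clauses I ! c))" for l
      using vars[OF that] by (auto simp: lit_val_def z_def)
    then have "(\<Sum>l\<leftarrow>fst (clauses I ! c). lit_val z l) = (\<Sum>l\<leftarrow>fst (clauses I ! c). of_bool (a (snd l) = fst l))"
      by (metis (mono_tags, lifting) map_eq_conv)
    also have "(\<Sum>l\<leftarrow>ls. of_bool (a (snd l) = fst l)) =
        int (length (filter (\<lambda>l. a (snd l) = fst l) ls))" for ls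
      by (induction ls) auto
    finally have lits: "(\<Sum>l\<leftarrow>fst (clauses I ! c). lit_val z l) = int (s c)" by (simp add: s_def)
    have "s c \<le> k" unfolding s_def using len by (metis length_filter_le)
    have "z (?n + j * ?m + c) = of_bool (j < s c - 2)" for j
      using c unfolding z_def by (simp add: add.assoc)
    then have "(\<Sum>j<k - 2. z (?n + j * ?m + c)) = int (card ({..<k - 2} \<inter> {j. j < s c - 2}))"
      by (simp add: sum_of_bool_eq)
    \<comment> \<open>A clause has at most \<open>k\<close> true literals, so its
      \<open>k - 2\<close> auxiliary variables suffice.\<close>
    also have "{..<k - 2} \<inter> {j. j < s c - 2} = {..<s c - 2}" using \<open>s c \<le> k\<close> by auto
    finally have sl: "slack k I z c = 2 * (int (s c) - int (s c - 2)) - 3"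
      unfolding slack_def lits by simp
    have s0: "s c = 0 \<longleftrightarrow> \<not> satisfies a (fst (clauses I ! c))"
      by (simp add: s_def satisfies_def filter_empty_conv case_prod_beta)
    show ?thesis
    proof (cases "satisfies a (fst (clauses I ! c))")
      case True
      then have "s c > 0" using s0 by simp
      \<comment> \<open>One true literal gives slack \<open>-1\<close>, as \<open>s c - 2\<close> is
        truncated to zero; two or more give slack \<open>1\<close>.\<close>
      then have "\<bar>slack k I z c\<bar> = 1" unfolding sl by auto
      then have "\<bar>real_of_int (slack k I z c)\<bar> = 1" by linarith
      then show ?thesis using True by simp
    next
      case False
      then have "s c = 0" using s0 by simp
      then show ?thesis using False by (simp add: sl)
    qed
  qed
  have "cost p k I z = real ?N * (1 + total_weight I) +
      (satisfied_weight a I + 3 powr p * (real (total_weight I) - satisfied_weight a I)) +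
      (1 + 3 powr p * threshold I)"
    unfolding cost_def 1 satisfied_weight_real[symmetric] using slack by simp
  moreover have "(3 powr p - 1) * threshold I \<le> (3 powr p - 1) * satisfied_weight a I"
    using three_powr_gt_one[OF p] a by (intro mult_left_mono) auto
  ultimately have "cost p k I z \<le> budget p k I"
    unfolding budget_def by (simp add: algebra_simps)
  then show ?thesis by blast
qed

section \<open>The lattice\<close>

lemma sum_lessThan_add:
  fixes f :: "nat \<Rightarrow> 'a::comm_monoid_add"
  shows "(\<Sum>i<a + b. f i) = (\<Sum>i<a. f i) + (\<Sum>i<b. f (a + i))"
  by (induction b) (auto simp: add.assoc)

lemma sum_lessThan_mult:
  fixes f :: "nat \<Rightarrow> 'a::comm_monoid_add"
  shows "(\<Sum>i<a * b. f i) = (\<Sum>i<a. \<Sum>j<b. f (i * b + j))"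
proof (induction a)
  case (Suc a)
  then show ?case using sum_lessThan_add[of f "a * b" b] by (simp add: add.commute)
qed simp

lemma nth_concat_replicate:
  "i < K \<Longrightarrow> j < length xs \<Longrightarrow> concat (replicate K xs) ! (i * length xs + j) = xs ! j"
proof (induction K arbitrary: i)
  case (Suc K)
  then show ?case by (cases i) (auto simp: nth_append add.assoc)
qed simp

lemma clause_at_eq: "c < num_clauses I \<Longrightarrow> clause_at I c = clauses I ! c"
  by (simp add: clause_at_def num_clauses_def nth_default_def)

lemma val_total_weight_expr: "val p (total_weight_expr I) = total_weight I"
  by (simp add: total_weight_expr_def val_sum_rexpr o_def total_weight_def num_clauses_def
      sum_list_sum_nth atLeast0LessThan)

lemma val_scale_expr: "val p (scale_expr I) = 1 + total_weight I"
  by (simp add: scale_expr_def val_total_weight_expr)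

lemma length_clause_row: "length (clause_row k I c) = reduction_rank k I"
  by (simp add: clause_row_def reduction_rank_def length_concat sum_list_replicate)

text \<open>The sums over variables and literals are exchanged: a literal contributes at exactly one
  index, which the hypothesis places below \<open>n\<close>.\<close>

lemma sum_var_coeffs:
  fixes z :: "nat \<Rightarrow> int"
  assumes "\<And>l. l \<in> set C \<Longrightarrow> snd l < n"
  shows "(\<Sum>i<n. val p (sum_rexpr (map (\<lambda>l.
      if snd l = i then (if fst l then Const 2 else Const (-2)) else Const 0) C)) * real_of_int (z i)) =
    (\<Sum>l\<leftarrow>C. (if fst l then 2 else -2) * real_of_int (z (snd l)))"
  using assms
proof (induction C)
  case (Cons l C)
  have "(\<Sum>i<n. val p (if snd l = i then (if fst l then Const 2 else Const (-2)) else Const 0) * real_of_int (z i)) =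
     (\<Sum>i<n. if snd l = i then (if fst l then 2 else -2) * real_of_int (z i) else 0)"
    by (intro sum.cong) auto
  also have "\<dots> = (if fst l then 2 else -2) * real_of_int (z (snd l))"
    using Cons.prems[of l] by simp
  finally show ?case using Cons by (simp add: distrib_right sum.distrib)
qed simp

lemma clause_row_dot:
  fixes z :: "nat \<Rightarrow> int"
  assumes I: "I \<in> weighted_max_ksat k" and c: "c < num_clauses I"
  shows "(\<Sum>j<reduction_rank k I. val p (clause_row k I c ! j) * real_of_int (z j)) -
      val p (clause_target_expr (clause_at I c)) =
    real (snd (clauses I ! c)) powr (1 / p) * real_of_int (slack k I z c)"
proof -
  let ?n = "num_vars I" and ?m = "num_clauses I"
  let ?C = "clauses I ! c"
  let ?w = "real (snd ?C) powr (1 / p)"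
  let ?f = "\<lambda>j. val p (clause_row k I c ! j) * real_of_int (z j)"
  note vars = weighted_max_ksatD(2)[OF I c]
  have "(\<Sum>j<?n. ?f j) = ?w * (\<Sum>i<?n. val p (sum_rexpr (map (\<lambda>l.
      if snd l = i then (if fst l then Const 2 else Const (-2)) else Const 0) (fst ?C))) * real_of_int (z i))"
    unfolding sum_distrib_left
    by (intro sum.cong) (auto simp: clause_row_def nth_append var_coeff_expr_def clause_at_eq[OF c])
  also have "\<dots> = ?w * (\<Sum>l\<leftarrow>fst ?C. (if fst l then 2 else -2) * real_of_int (z (snd l)))"
    using sum_var_coeffs[OF vars] by simp
  finally have 1: "(\<Sum>j<?n. ?f j) = \<dots>" .
  have "(\<Sum>j<(k - 2) * ?m. ?f (?n + j)) = (\<Sum>i<k - 2. \<Sum>j<?m. ?f (?n + (i * ?m + j)))"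
    by (rule sum_lessThan_mult)
  \<comment> \<open>Within each block of auxiliary columns, only column \<open>c\<close> contributes
    to this row.\<close>
  also have "\<dots> = (\<Sum>i<k - 2. \<Sum>j<?m. if j = c then - 2 * ?w * real_of_int (z (?n + i * ?m + c)) else 0)"
  proof (intro sum.cong refl)
    fix i j assume "i \<in> {..<k - 2}" "j \<in> {..<?m}"
    then have "clause_row k I c ! (?n + (i * ?m + j)) =
        (if j = c then Mul (PRoot (Const (int (snd ?C)))) (Const (-2)) else Const 0)"
      using nth_concat_replicate[of i "k - 2" j "map (\<lambda>c'. if c' = c
       then Mul (PRoot (Const (int (snd (clause_at I c))))) (Const (-2)) else Const 0) [0..<?m]"]
      by (simp add: clause_row_def nth_append clause_at_eq[OF c])
    then show "?f (?n + (i * ?m + j)) =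
        (if j = c then - 2 * ?w * real_of_int (z (?n + i * ?m + c)) else 0)"
      by (auto simp: add.assoc)
  qed
  also have "\<dots> = - 2 * ?w * (\<Sum>i<k - 2. real_of_int (z (?n + i * ?m + c)))"
    using c by (simp add: sum_distrib_left)
  finally have 2: "(\<Sum>j<(k - 2) * ?m. ?f (?n + j)) = \<dots>" .
  \<comment> \<open>Doubling separates the linear part, which the row holds, from the constant part,
    which the target holds.\<close>
  have lits: "real_of_int (\<Sum>l\<leftarrow>ls. lit_val z l) * 2 =
      (\<Sum>l\<leftarrow>ls. (if fst l then 2 else -2) * real_of_int (z (snd l))) -
      val p (sum_rexpr (map (\<lambda>l. if fst l then Const 0 else Const (-2)) ls))" for ls
    by (induction ls) (auto simp: lit_val_def algebra_simps)
  have S: "(\<Sum>j<reduction_rank k I. ?f j) = ?w * (\<Sum>l\<leftarrow>fst ?C. (if fst l then 2 else -2) * real_of_int (z (snd l))) -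
      2 * ?w * (\<Sum>i<k - 2. real_of_int (z (?n + i * ?m + c)))"
    unfolding reduction_rank_def sum_lessThan_add 1 2 by simp
  have T: "val p (clause_target_expr (clause_at I c)) =
      ?w * (3 + val p (sum_rexpr (map (\<lambda>l. if fst l then Const 0 else Const (-2)) (fst ?C))))"
    by (simp add: clause_target_expr_def clause_at_eq[OF c])
  have U: "real_of_int (slack k I z c) =
      real_of_int (\<Sum>l\<leftarrow>fst ?C. lit_val z l) * 2 -
      2 * (\<Sum>i<k - 2. real_of_int (z (?n + i * ?m + c))) - 3"
    unfolding slack_def by (simp add: algebra_simps)
  show ?thesis unfolding S T U lits by (simp add: algebra_simps)
qed

section \<open>Shape, coordinates and distances of the constructed instance\<close>

lemma well_shaped_reduction: "well_shaped (reduction k I)"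
  by (auto simp: well_shaped_def reduction_def Let_def length_clause_row)

lemma desc_basis_dim:
  "dim_row (desc_basis p (reduction k I)) = reduction_rank k I + num_clauses I + 1"
  "dim_col (desc_basis p (reduction k I)) = reduction_rank k I"
  by (simp_all add: desc_basis_def mat_of_rows_list_def reduction_def Let_def)

lemma desc_vec_dim: "dim_vec (desc_vec p (reduction k I)) = reduction_rank k I + num_clauses I + 1"
  by (simp add: desc_vec_def reduction_def Let_def)

lemma desc_basis_mult_nth:
  assumes "v \<in> carrier_vec (reduction_rank k I)" "i < reduction_rank k I + num_clauses I + 1"
  shows "(desc_basis p (reduction k I) *\<^sub>v v) $ i =
    (\<Sum>j<reduction_rank k I. val p (desc_rows (reduction k I) ! i ! j) * v $ j)"
proof -
  have "i < length (desc_rows (reduction k I))"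
    using assms(2) by (simp add: reduction_def Let_def)
  moreover have rank: "desc_rank (reduction k I) = reduction_rank k I"
    by (simp add: reduction_def Let_def)
  moreover have "length (desc_rows (reduction k I) ! i) = reduction_rank k I"
    using well_shaped_reduction[of k I] nth_mem[OF calculation(1)] rank
    unfolding well_shaped_def by metis
  ultimately show ?thesis using assms(1)
    by (simp add: desc_basis_def mat_of_rows_list_def scalar_prod_def row_def atLeast0LessThan)
qed

text \<open>Stated for real vectors, as it serves linear independence besides the distance
  computation.\<close>

lemma desc_basis_mult_diag:
  assumes v: "v \<in> carrier_vec (reduction_rank k I)" and i: "i < reduction_rank k I"
  shows "(desc_basis p (reduction k I) *\<^sub>v v) $ i = (1 + real (total_weight I)) powr (1 / p) * 2 * v $ i"
proof -
  have "(desc_basis p (reduction k I) *\<^sub>v v) $ i = (\<Sum>j<reduction_rank k I.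
      if j = i then (1 + real (total_weight I)) powr (1 / p) * 2 * v $ j else 0)"
    using i by (subst desc_basis_mult_nth[OF v], simp, intro sum.cong)
      (auto simp: reduction_def Let_def nth_append val_scale_expr)
  then show ?thesis using i by simp
qed

text \<open>This is why entries are scaled by roots: a weight then enters the \<open>p\<close>-th
  power of the norm linearly.\<close>

lemma powr_root_mult:
  fixes p A x :: real
  assumes "p \<ge> 1" "A \<ge> 0"
  shows "\<bar>A powr (1 / p) * x\<bar> powr p = A * \<bar>x\<bar> powr p"
proof -
  have "p \<noteq> 0" using assms(1) by linarith
  then show ?thesis using assms(2) by (simp add: abs_mult powr_mult powr_powr)
qed

lemma lp_norm_lattice_point:
  assumes p: "p \<ge> 1" and I: "I \<in> weighted_max_ksat k" and z: "z \<in> carrier_vec (reduction_rank k I)"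
  shows "lp_norm p (desc_basis p (reduction k I) *\<^sub>v map_vec real_of_int z - desc_vec p (reduction k I)) =
    cost p k I (\<lambda>i. z $ i) powr (1 / p)"
proof -
  let ?N = "reduction_rank k I" and ?m = "num_clauses I"
  let ?v = "map_vec real_of_int z"
  let ?A = "1 + real (total_weight I)"
  let ?x = "desc_basis p (reduction k I) *\<^sub>v ?v - desc_vec p (reduction k I)"
  have v: "?v \<in> carrier_vec ?N" using z by simp
  have dim: "dim_vec ?x = ?N + ?m + 1" by (simp add: desc_vec_dim)
  have x: "?x $ i = (desc_basis p (reduction k I) *\<^sub>v ?v) $ i - val p (desc_target (reduction k I) ! i)"
    if "i < ?N + ?m + 1" for i
    using that desc_vec_dim[of p k I]
    by (auto simp: desc_vec_def desc_basis_dim vec_of_list_index simp del: vec_of_list_map)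
  have "\<bar>?x $ i\<bar> powr p = ?A * \<bar>2 * real_of_int (z $ i) - 1\<bar> powr p" if i: "i < ?N" for i
  proof -
    have "?x $ i = ?A powr (1 / p) * (2 * real_of_int (z $ i) - 1)"
      using i z desc_basis_mult_diag[OF v i, of p]
      by (simp add: x algebra_simps) (simp add: reduction_def Let_def nth_append val_scale_expr algebra_simps)
    then show ?thesis using powr_root_mult[OF p, of ?A] by simp
  qed
  then have 1: "(\<Sum>i<?N. \<bar>?x $ i\<bar> powr p) = (\<Sum>i<?N. ?A * \<bar>2 * real_of_int (z $ i) - 1\<bar> powr p)"
    by simp
  have "\<bar>?x $ (?N + c)\<bar> powr p = snd (clauses I ! c) * \<bar>real_of_int (slack k I (\<lambda>i. z $ i) c)\<bar> powr p"
    if c: "c < ?m" for c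
  proof -
    have "desc_rows (reduction k I) ! (?N + c) = clause_row k I c"
      "desc_target (reduction k I) ! (?N + c) = clause_target_expr (clause_at I c)"
      using c by (simp_all add: reduction_def Let_def nth_append)
    then have "?x $ (?N + c) = (\<Sum>j<?N. val p (clause_row k I c ! j) * real_of_int (z $ j)) -
        val p (clause_target_expr (clause_at I c))"
      using c z by (simp add: x desc_basis_mult_nth[OF v])
    also have "\<dots> = real (snd (clauses I ! c)) powr (1 / p) * real_of_int (slack k I (\<lambda>i. z $ i) c)"
      by (rule clause_row_dot[OF I c])
    finally show ?thesis using powr_root_mult[OF p] by simp
  qed
  then have 2: "(\<Sum>c<?m. \<bar>?x $ (?N + c)\<bar> powr p) =
      (\<Sum>c<?m. snd (clauses I ! c) * \<bar>real_of_int (slack k I (\<lambda>i. z $ i) c)\<bar> powr p)"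
    by simp
  have "desc_rows (reduction k I) ! (?N + ?m) = map (\<lambda>j. Const 0) [0..<?N]"
    "desc_target (reduction k I) ! (?N + ?m) =
       PRoot (Add (Const 1) (Mul (PPow (Const 3)) (Const (int (threshold I)))))"
    by (simp_all add: reduction_def Let_def nth_append)
  \<comment> \<open>The zero row contributes its target entry alone, whatever the lattice
    point.\<close>
  then have "?x $ (?N + ?m) = - ((1 + 3 powr p * threshold I) powr (1 / p))"
    using z by (simp add: x desc_basis_mult_nth[OF v])
  then have 3: "\<bar>?x $ (?N + ?m)\<bar> powr p = 1 + 3 powr p * threshold I"
    using p by (simp add: powr_powr)
  have "(\<Sum>i<dim_vec ?x. \<bar>?x $ i\<bar> powr p) = cost p k I (\<lambda>i. z $ i)"
    unfolding dim cost_def by (simp only: sum_lessThan_add 1 2) (simp add: 3)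
  then show ?thesis unfolding lp_norm_def by simp
qed

lemma budget_pos: "budget p k I > 0"
  unfolding budget_def by (simp add: add_pos_nonneg)

lemma cost_nonneg: "cost p k I z \<ge> 0"
  unfolding cost_def by (intro add_nonneg_nonneg sum_nonneg mult_nonneg_nonneg) auto

lemma desc_r_reduction: "desc_r p (reduction k I) = budget p k I powr (1 / p)"
proof -
  have "val p (sum_rexpr (map (\<lambda>i. scale_expr I) [0..<n])) = n * (1 + real (total_weight I))" for n
    by (simp add: val_sum_rexpr o_def val_scale_expr sum_list_triv)
  \<comment> \<open>\<open>PRoot\<close> takes the root of an absolute value, which is the budget
    itself because the budget is positive.\<close>
  then have "desc_r p (reduction k I) = \<bar>budget p k I\<bar> powr (1 / p)"
    by (simp add: desc_r_def reduction_def Let_def budget_def val_total_weight_expr algebra_simps)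
  then show ?thesis using budget_pos[of p k I] by simp
qed

lemma cvp_instance_reduction:
  "cvp_instance (reduction_rank k I) (desc_basis p (reduction k I)) (desc_vec p (reduction k I))
     (desc_r p (reduction k I))"
proof -
  let ?N = "reduction_rank k I" and ?B = "desc_basis p (reduction k I)"
  have "lin_indep_cols ?B" unfolding lin_indep_cols_def desc_basis_dim
  proof (intro ballI impI)
    fix x assume x: "x \<in> carrier_vec ?N" and 0: "?B *\<^sub>v x = 0\<^sub>v (?N + num_clauses I + 1)"
    \<comment> \<open>The \<open>1\<close> keeps the diagonal nonzero even for a formula without
      clauses.\<close>
    have "1 + real (total_weight I) > 0" by simp
    then have "x $ i = 0" if "i < ?N" for i
      using desc_basis_mult_diag[OF x that, of p] that unfolding 0 by simp
    then show "x = 0\<^sub>v ?N" using x by (intro eq_vecI) auto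
  qed
  moreover have "desc_vec p (reduction k I) \<in> carrier_vec (dim_row ?B)"
    by (rule carrier_vecI) (simp only: desc_basis_dim desc_vec_dim)
  moreover have "desc_r p (reduction k I) > 0"
    using budget_pos[of p k I] unfolding desc_r_reduction by simp
  ultimately show ?thesis unfolding cvp_instance_def desc_basis_dim by blast
qed

lemma max_sat_yes_iff_cvp_yes:
  assumes p: "p \<ge> 1" and k: "k \<ge> 2" and I: "I \<in> weighted_max_ksat k"
  shows "max_sat_yes I \<longleftrightarrow> cvp_yes p (desc_basis p (reduction k I)) (desc_vec p (reduction k I))
     (desc_r p (reduction k I))"
proof -
  let ?N = "reduction_rank k I" and ?B = "desc_basis p (reduction k I)"
  let ?t = "desc_vec p (reduction k I)" and ?r = "desc_r p (reduction k I)"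
  let ?d = "\<lambda>x. lp_norm p (x - ?t)"
  let ?pt = "\<lambda>z. ?B *\<^sub>v map_vec real_of_int z"
  \<comment> \<open>Taking \<open>p\<close>-th roots is strictly monotone on nonnegative numbers, so
    distance and radius compare like \<open>cost\<close> and \<open>budget\<close>.\<close>
  have le: "?d (?pt z) \<le> ?r \<longleftrightarrow> cost p k I (\<lambda>i. z $ i) \<le> budget p k I" if "z \<in> carrier_vec ?N" for z
    unfolding lp_norm_lattice_point[OF p I that] desc_r_reduction
    using p cost_nonneg[of p k I "\<lambda>i. z $ i"] budget_pos[of p k I]
      powr_mono2[of "1 / p" "cost p k I (\<lambda>i. z $ i)" "budget p k I"]
      powr_less_mono2[of "1 / p" "budget p k I" "cost p k I (\<lambda>i. z $ i)"]
    by (fastforce simp: not_le[symmetric])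
  have lat: "lattice_of ?B = ?pt ` carrier_vec ?N"
    unfolding lattice_of_def desc_basis_dim by auto
  show ?thesis
  proof
    assume "max_sat_yes I"
    then obtain z where z: "cost p k I z \<le> budget p k I"
      using cost_le_budget_if_satisfied_weight[OF p I k] unfolding max_sat_yes_def by blast
    \<comment> \<open>Only binary coordinate vectors stay within the budget, so the minimum is over a finite set.\<close>
    let ?Z = "{z \<in> carrier_vec ?N. cost p k I (\<lambda>i. z $ i) \<le> budget p k I}"
    have "?Z \<subseteq> vec_of_list ` {xs. set xs \<subseteq> {0, 1} \<and> length xs = ?N}"
    proof
      fix y assume y: "y \<in> ?Z"
      have "y $ i \<in> {0, 1}" if "i < ?N" for i
        by (rule binary_if_cost_le_budget[OF p _ that]) (use y in simp)
      then have "set (list_of_vec y) \<subseteq> {0, 1}"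
        using y by (fastforce simp: in_set_conv_nth list_of_vec_index)
      then show "y \<in> vec_of_list ` {xs. set xs \<subseteq> {0, 1} \<and> length xs = ?N}"
        using y by (intro image_eqI[where x = "list_of_vec y"]) (auto simp: vec_list)
    qed
    then have fin: "finite ?Z"
      by (rule finite_subset) (intro finite_imageI finite_lists_length_eq, simp)
    have "cost p k I (\<lambda>i. vec ?N z $ i) = cost p k I z"
      by (rule cost_cong[OF I]) simp
    then have "vec ?N z \<in> ?Z" using z by simp
    then have "?Z \<noteq> {}" by blast
    from ex_is_arg_min_if_finite[OF fin this, of "\<lambda>z. ?d (?pt z)"]
    obtain y where y: "y \<in> ?Z" and min: "\<And>z. z \<in> ?Z \<Longrightarrow> ?d (?pt y) \<le> ?d (?pt z)"
      unfolding is_arg_min_linorder by auto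
    \<comment> \<open>Vectors outside \<open>?Z\<close> give points beyond the radius, while the
      point of \<open>y\<close> lies within it.\<close>
    have "?d (?pt y) \<le> ?d (?pt z)" if "z \<in> carrier_vec ?N" for z
      using min[of z] le[of z] le[of y] y that by fastforce
    then have "is_arg_min ?d (\<lambda>x. x \<in> lattice_of ?B) (?pt y)"
      unfolding is_arg_min_linorder lat using y by auto
    then show "cvp_yes p ?B ?t ?r"
      unfolding cvp_yes_def using le[of y] y by blast
  next
    assume "cvp_yes p ?B ?t ?r"
    then obtain z where "z \<in> carrier_vec ?N" "?d (?pt z) \<le> ?r"
      unfolding cvp_yes_def is_arg_min_def lat by blast
    then have "cost p k I (\<lambda>i. z $ i) \<le> budget p k I" using le by blast
    from satisfied_weight_if_cost_le_budget[OF p this I] show "max_sat_yes I"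
      unfolding max_sat_yes_def by blast
  qed
qed

theorem theorem6p2:
  fixes p :: "nat \<Rightarrow> real" and k :: nat and S :: "wcnf set"
  assumes "\<And>n. p n \<ge> 1"
    and "k \<ge> 2"
    and "S = weighted_max_ksat k \<or> S = max_ksat k"
  shows "\<exists>f. poly_time_computable enc_wcnf enc_cvp_desc S f \<and>
    (\<forall>I\<in>S. \<forall>n m q B t r.
       n = num_vars I \<and> m = num_clauses I \<and> q = p n \<and>
       B = desc_basis q (f I) \<and> t = desc_vec q (f I) \<and> r = desc_r q (f I) \<longrightarrow>
       well_shaped (f I) \<and>
       cvp_instance (n + (k - 2) * m) B t r \<and>
       (max_sat_yes I \<longleftrightarrow> cvp_yes q B t r))"
proof (intro exI[of _ "reduction k"] conjI ballI allI impI)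
  \<comment> \<open>One function serves every \<open>p\<close>: the exponent enters only when the
    expressions are evaluated.\<close>
  show "poly_time_computable enc_wcnf enc_cvp_desc S (reduction k)"
    by (rule computes_poly_time_computable[OF computes_reduction])
next
  fix I n m q B t r
  assume "I \<in> S" and eqs: "n = num_vars I \<and> m = num_clauses I \<and> q = p n \<and>
       B = desc_basis q (reduction k I) \<and> t = desc_vec q (reduction k I) \<and> r = desc_r q (reduction k I)"
  then have I: "I \<in> weighted_max_ksat k"
    using assms(3) unfolding max_ksat_def by blast
  show "well_shaped (reduction k I)" by (rule well_shaped_reduction)
  show "cvp_instance (n + (k - 2) * m) B t r"
    using cvp_instance_reduction[of k I q] eqs by (simp add: reduction_rank_def)
  show "max_sat_yes I \<longleftrightarrow> cvp_yes q B t r"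
    using max_sat_yes_iff_cvp_yes[OF assms(1,2) I] eqs by simp
qed

end
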